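(* Let $-\infty<s_-<s_+<+\infty$, $\eta_\pm\in\hat{\mathbb C}$ with $\eta_-\ne\eta_+$, $\kappa\in\mathbb C\setminus\{0\}$, and $\gamma=\operatorname{Arg}_0\kappa$. Then the following statements are equivalent: (i) the control system (with spectral parameter $\kappa$) is controllable from $\eta_-$ to $\eta_+$, i.e., some feasible control steers $\eta_-$ to $\eta_+$ in some finite time $t\ge 0$; (ii) there exists a minimum-time control $\varepsilon(\cdot)\in\mathbb F_{s_-}$ that steers $\eta_-$ to $\eta_+$ in the minimal time $T^{\min}_\kappa(\eta_-,\eta_+)$; (iii) the complex argument $\gamma$ is achievable over $\mathbb F_{s_-,s_+}$, i.e., $\gamma\in\operatorname{Arg}_0\Sigma^{s_-,s_+}_{\eta_-,\eta_+}[\mathbb F_{s_-,s_+}]$; (iv) there exists at least one resonator $\varepsilon^{\min}_\gamma(\cdot)\in\mathbb F_{s_-,s_+}$ of minimal modulus for $\gamma$. If (i)–(iv) hold true, then $$T^{\min}_\kappa(\eta_-,\eta_+)=\frac{(s_+-s_-)\,\rho_{\min}(\gamma,\eta_-,\eta_+)}{|\kappa|}.$$ If, additionally, $s_\pm$ are chosen so that $s_+-s_-=T^{\min}_\kappa(\eta_-,\eta_+)$, then the family of minimum-time controls from $x(s_-)=\eta_-$ to $\eta_+$ (restricted to $(s_-,s_+)$) and the family of resonators of minimal modulus for $\gamma$ over $\mathbb F_{s_-,s_+}$ coincide.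
   Context: Fix constants $0<n_1<n_2$. $\hat{\mathbb C}=\mathbb C\cup\{\infty\}$; $\operatorname{Arg}_0$ is the principal argument with values in $(-\pi,\pi]$; $\inf\varnothing=+\infty$. Feasible controls: $\mathbb F_{s_-}=\{\varepsilon\in L^\infty((s_-,\infty);\mathbb R): n_1^2\le\varepsilon\le n_2^2\text{ a.e.}\}$; on an interval, $\mathbb F_{s_-,s_+}=\{\varepsilon\in L^\infty((s_-,s_+);\mathbb R): n_1^2\le\varepsilon\le n_2^2\text{ a.e.}\}$. Control system: the state $x(s)\in\hat{\mathbb C}$ evolves by $x'=\mathrm i\kappa(-x^2+\varepsilon)$ in the chart $\mathbb C$ and, near $\infty$, by $\tilde x'=\mathrm i\kappa(-1+\varepsilon\tilde x^2)$ for $\tilde x=-1/x$. $T^{\min}_\kappa(\eta_-,\eta_+)\in[0,+\infty]$ is the infimum of $t\ge0$ such that some $\varepsilon\in\mathbb F_{s_-}$ steers $x(s_-)=\eta_-$ to $x(s_-+t)=\eta_+$ (independent of $s_-$); a control that does so in time $T^{\min}_\kappa(\eta_-,\eta_+)$ is called a minimum-time control. Eigenvalues: for $\varepsilon\in\mathbb F_{s_-,s_+}$, $\Sigma^{s_-,s_+}_{\eta_-,\eta_+}(\varepsilon)$ is the set of $k\in\mathbb C\setminus\{0\}$ such that $y''=-k^2\varepsilon y$ on $(s_-,s_+)$ has a nontrivial solution with $\frac{y'(s_\pm)}{\mathrm i k\,y(s_\pm)}=\eta_\pm$ (understood as $y(s_\pm)=0$ when $\eta_\pm=\infty$). $\Sigma^{s_-,s_+}_{\eta_-,\eta_+}[\mathbb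 F_{s_-,s_+}]=\bigcup_{\varepsilon\in\mathbb F_{s_-,s_+}}\Sigma^{s_-,s_+}_{\eta_-,\eta_+}(\varepsilon)$, and $\operatorname{Arg}_0$ of this set is the set of the values $\operatorname{Arg}_0 k$ of its elements. The minimal modulus is $\rho_{\min}(\gamma)=\rho_{\min}(\gamma,\eta_-,\eta_+)=\inf\{|k|: k\in\Sigma^{s_-,s_+}_{\eta_-,\eta_+}[\mathbb F_{s_-,s_+}],\ \operatorname{Arg}_0k=\gamma\}$. A function $\varepsilon\in\mathbb F_{s_-,s_+}$ with $e^{\mathrm i\gamma}\rho_{\min}(\gamma)\in\Sigma^{s_-,s_+}_{\eta_-,\eta_+}(\varepsilon)$ is called a resonator of minimal modulus for $\gamma$. *)

theory Defs
  imports "HOL-Analysis.Analysis"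
begin

text \<open>The Riemann sphere carries the topology of \<^const>\<open>Alexandroff_compactification\<close>,
  in which \<^const>\<open>None\<close> is the point at infinity.\<close>

type_synonym sphere = "complex option"

abbreviation sphere_topology :: "sphere topology" where
  "sphere_topology \<equiv> Alexandroff_compactification (euclidean :: complex topology)"

text \<open>The coordinate -1/x of the chart at infinity; its domain is the sphere without
  the point 0, so the value at \<^term>\<open>Some 0\<close> is irrelevant.\<close>

definition chart_infinity :: "sphere \<Rightarrow> complex" where
  "chart_infinity p = (case p of None \<Rightarrow> 0 | Some z \<Rightarrow> - 1 / z)"

text \<open>Elements of L-infinity are represented by Lebesgue measurable functions; values
  outside the interval I are irrelevant.\<close>

definition feasible :: "real \<Rightarrow> real \<Rightarrow> real set \<Rightarrow> (real \<Rightarrow> real) set" where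
  "feasible n1 n2 I =
    {\<epsilon> \<in> borel_measurable (lebesgue_on I). AE s in lebesgue_on I. n1\<^sup>2 \<le> \<epsilon> s \<and> \<epsilon> s \<le> n2\<^sup>2}"

text \<open>Absolutely continuous solutions on [a, b] of f'(s) = F s (f s) for almost every s,
  in integrated form.\<close>

definition caratheodory_solution ::
    "(real \<Rightarrow> complex \<Rightarrow> complex) \<Rightarrow> real \<Rightarrow> real \<Rightarrow> (real \<Rightarrow> complex) \<Rightarrow> bool" where
  "caratheodory_solution F a b f \<longleftrightarrow>
    (\<lambda>s. F s (f s)) absolutely_integrable_on {a..b} \<and>
    (\<forall>t\<in>{a..b}. f t = f a + integral {a..t} (\<lambda>s. F s (f s)))"

text \<open>The continuity clause rules out jumps between the two charts.\<close>

definition trajectory ::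
    "complex \<Rightarrow> (real \<Rightarrow> real) \<Rightarrow> real \<Rightarrow> real \<Rightarrow> (real \<Rightarrow> sphere) \<Rightarrow> bool" where
  "trajectory \<kappa> \<epsilon> a b x \<longleftrightarrow>
    continuous_map (top_of_set {a..b}) sphere_topology x \<and>
    (\<forall>c d. {c..d} \<subseteq> {a..b} \<and> (\<forall>s\<in>{c..d}. x s \<noteq> None) \<longrightarrow>
      caratheodory_solution (\<lambda>s z. \<i> * \<kappa> * (- z\<^sup>2 + of_real (\<epsilon> s))) c d (\<lambda>s. the (x s))) \<and>
    (\<forall>c d. {c..d} \<subseteq> {a..b} \<and> (\<forall>s\<in>{c..d}. x s \<noteq> Some 0) \<longrightarrow>
      caratheodory_solution (\<lambda>s z. \<i> * \<kappa> * (- 1 + of_real (\<epsilon> s) * z\<^sup>2)) c d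
        (\<lambda>s. chart_infinity (x s)))"

definition steers ::
    "complex \<Rightarrow> (real \<Rightarrow> real) \<Rightarrow> real \<Rightarrow> real \<Rightarrow> sphere \<Rightarrow> sphere \<Rightarrow> bool" where
  "steers \<kappa> \<epsilon> s t \<eta>1 \<eta>2 \<longleftrightarrow>
    (\<exists>x. trajectory \<kappa> \<epsilon> s (s + t) x \<and> x s = \<eta>1 \<and> x (s + t) = \<eta>2)"

definition controllable ::
    "real \<Rightarrow> real \<Rightarrow> complex \<Rightarrow> real \<Rightarrow> sphere \<Rightarrow> sphere \<Rightarrow> bool" where
  "controllable n1 n2 \<kappa> s \<eta>1 \<eta>2 \<longleftrightarrow>
    (\<exists>\<epsilon> \<in> feasible n1 n2 {s<..}. \<exists>t\<ge>0. steers \<kappa> \<epsilon> s t \<eta>1 \<eta>2)"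

text \<open>The system being autonomous, the initial time s does not affect the value of the
  minimal time; it is kept as an argument rather than normalised.\<close>

definition min_time ::
    "real \<Rightarrow> real \<Rightarrow> complex \<Rightarrow> real \<Rightarrow> sphere \<Rightarrow> sphere \<Rightarrow> ereal" where
  "min_time n1 n2 \<kappa> s \<eta>1 \<eta>2 =
    Inf {ereal t | t. 0 \<le> t \<and> (\<exists>\<epsilon> \<in> feasible n1 n2 {s<..}. steers \<kappa> \<epsilon> s t \<eta>1 \<eta>2)}"

definition min_time_controls ::
    "real \<Rightarrow> real \<Rightarrow> complex \<Rightarrow> real \<Rightarrow> sphere \<Rightarrow> sphere \<Rightarrow> (real \<Rightarrow> real) set" where
  "min_time_controls n1 n2 \<kappa> s \<eta>1 \<eta>2 =
    {\<epsilon> \<in> feasible n1 n2 {s<..}.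
      \<exists>t\<ge>0. ereal t = min_time n1 n2 \<kappa> s \<eta>1 \<eta>2 \<and> steers \<kappa> \<epsilon> s t \<eta>1 \<eta>2}"

text \<open>The condition v / (i k u) = \<eta> for u = y(s) and v = y'(s). For finite \<eta> it requires
  u to be nonzero, since division by zero yields 0 in HOL.\<close>

definition boundary_condition :: "complex \<Rightarrow> sphere \<Rightarrow> complex \<Rightarrow> complex \<Rightarrow> bool" where
  "boundary_condition k \<eta> u v \<longleftrightarrow>
    (case \<eta> of None \<Rightarrow> u = 0 | Some w \<Rightarrow> u \<noteq> 0 \<and> v / (\<i> * k * u) = w)"

text \<open>The solution y is continuously differentiable up to the end points, and its
  derivative y' is absolutely continuous with y'' = - k^2 \<epsilon> y almost everywhere.\<close>

definition eigenvalues ::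
    "real \<Rightarrow> real \<Rightarrow> sphere \<Rightarrow> sphere \<Rightarrow> (real \<Rightarrow> real) \<Rightarrow> complex set" where
  "eigenvalues s1 s2 \<eta>1 \<eta>2 \<epsilon> =
    {k. k \<noteq> 0 \<and> (\<exists>y y'.
      (\<forall>s\<in>{s1..s2}. (y has_vector_derivative y' s) (at s within {s1..s2})) \<and>
      caratheodory_solution (\<lambda>s _. - k\<^sup>2 * of_real (\<epsilon> s) * y s) s1 s2 y' \<and>
      (\<exists>s\<in>{s1..s2}. y s \<noteq> 0) \<and>
      boundary_condition k \<eta>1 (y s1) (y' s1) \<and>
      boundary_condition k \<eta>2 (y s2) (y' s2))}"

definition feasible_eigenvalues ::
    "real \<Rightarrow> real \<Rightarrow> real \<Rightarrow> real \<Rightarrow> sphere \<Rightarrow> sphere \<Rightarrow> complex set" where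
  "feasible_eigenvalues n1 n2 s1 s2 \<eta>1 \<eta>2 =
    (\<Union>\<epsilon> \<in> feasible n1 n2 {s1<..<s2}. eigenvalues s1 s2 \<eta>1 \<eta>2 \<epsilon>)"

definition min_modulus ::
    "real \<Rightarrow> real \<Rightarrow> real \<Rightarrow> real \<Rightarrow> sphere \<Rightarrow> sphere \<Rightarrow> real \<Rightarrow> ereal" where
  "min_modulus n1 n2 s1 s2 \<eta>1 \<eta>2 \<gamma> =
    Inf {ereal (cmod k) | k. k \<in> feasible_eigenvalues n1 n2 s1 s2 \<eta>1 \<eta>2 \<and> Arg k = \<gamma>}"

definition min_modulus_resonators ::
    "real \<Rightarrow> real \<Rightarrow> real \<Rightarrow> real \<Rightarrow> sphere \<Rightarrow> sphere \<Rightarrow> real \<Rightarrow> (real \<Rightarrow> real) set" where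
  "min_modulus_resonators n1 n2 s1 s2 \<eta>1 \<eta>2 \<gamma> =
    {\<epsilon> \<in> feasible n1 n2 {s1<..<s2}.
      \<exists>\<rho>. ereal \<rho> = min_modulus n1 n2 s1 s2 \<eta>1 \<eta>2 \<gamma> \<and>
          cis \<gamma> * of_real \<rho> \<in> eigenvalues s1 s2 \<eta>1 \<eta>2 \<epsilon>}"

end

theory Submission
  imports Defs "HOL-Complex_Analysis.Great_Picard"
begin

text \<open>Put w = y' / (i k). The equation y'' = - k^2 \<epsilon> y becomes the linear system y' = i k w,
w' = i k \<epsilon> y, and x = w / y, read as a point of the sphere with homogeneous coordinates, solves
the control system x' = i k (- x^2 + \<epsilon>). Conversely every trajectory on the sphere is the
ratio of a nowhere vanishing solution of the linear system (\<open>trajectory_lifts\<close>): in the finite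
chart y is the exponential of the integral of i k x, in the chart at infinity w is an
exponential of the same kind, and two local lifts differ by a constant factor. Hence a control
steers \<eta>1 to \<eta>2 in time t exactly if the spectral parameter \<kappa> is an eigenvalue of this control
on an interval of length t (\<open>steers_iff_linked\<close>, \<open>eigenvalue_iff_linked\<close>).

Stretching an interval of length t to the length L = s2 - s1 replaces \<kappa> by \<kappa> t / L, which has
the same argument (\<open>linkable_rescale\<close>). So the set of transfer times is the set R of moduli of
the eigenvalues with argument \<gamma>, multiplied by L / |\<kappa>|. This gives the equivalence of
controllability with achievability of \<gamma>, the formula for the minimal time, and the coincidence
of the two families of optimal controls when the minimal time is L.

What is left is that the infimum of R is attained if R is not empty. If k n converges to k' and
k n is an eigenvalue for some feasible control \<epsilon> n, then k' is an eigenvalue for some feasible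
control, or k' = 0 (\<open>linked_compact\<close>). The normalised solutions (y n, w n) are equi-Lipschitz
by Gronwall, and so are the primitives G n of the controls; by Arzela-Ascoli all three converge
uniformly along a subsequence. The growth rate of the limit H of the G n still lies between n1^2
and n2^2, so H is the integral of a feasible control by the Radon-Nikodym theorem
(\<open>control_of_primitive\<close>), which plays the role of the weak limit of the controls. In the
integral equation for w n the product of \<epsilon> n, which converges only weakly, and y n is turned by
partial integration into an expression in G n, y n and w n, where the limit is harmless.
Finally, for k' = 0 the solutions are constant, so that the two boundary values would agree;
as \<eta>1 and \<eta>2 differ, the infimum of R is positive.\<close>

section \<open>Functions with bounded derivative almost everywhere\<close>

text \<open>Absolutely continuous functions with a bounded derivative. Boundedness costs nothing here,
since controls are bounded, and it makes f Lipschitz, so that differentiation rules can be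
checked without differentiating f.\<close>

definition primitive_on :: "real \<Rightarrow> real \<Rightarrow> (real \<Rightarrow> complex) \<Rightarrow> (real \<Rightarrow> complex) \<Rightarrow> bool" where
  "primitive_on a b f F \<longleftrightarrow>
    F \<in> borel_measurable (lebesgue_on {a..b}) \<and> (\<exists>B. \<forall>s\<in>{a..b}. norm (F s) \<le> B) \<and>
    (\<forall>t\<in>{a..b}. f t = f a + integral {a..t} F)"

lemma bounded_measurable_imp_absolutely_integrable:
  fixes F :: "real \<Rightarrow> complex"
  assumes "F \<in> borel_measurable (lebesgue_on {a..b})" "\<forall>s\<in>{a..b}. norm (F s) \<le> B" "{c..d} \<subseteq> {a..b}"
  shows "F absolutely_integrable_on {c..d}"
proof -
  have "F absolutely_integrable_on {a..b}"
    by (rule measurable_bounded_by_integrable_imp_absolutely_integrable[where g="\<lambda>_. B"]) (use assms in auto)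
  then show ?thesis
    by (rule absolutely_integrable_on_subinterval) (use assms in auto)
qed

lemma primitive_onD:
  assumes "primitive_on a b f F" "t \<in> {a..b}"
  shows "f t = f a + integral {a..t} F"
  using assms unfolding primitive_on_def by blast

lemma primitive_on_absolutely_integrable:
  assumes "primitive_on a b f F" "{c..d} \<subseteq> {a..b}"
  shows "F absolutely_integrable_on {c..d}"
  using assms unfolding primitive_on_def by (meson bounded_measurable_imp_absolutely_integrable)

lemma primitive_on_integrable:
  assumes "primitive_on a b f F" "{c..d} \<subseteq> {a..b}"
  shows "F integrable_on {c..d}"
  using primitive_on_absolutely_integrable[OF assms] set_lebesgue_integral_eq_integral(1) by blast

lemma primitive_on_diff:
  assumes p: "primitive_on a b f F" and "a \<le> s" "s \<le> t" "t \<le> b"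
  shows "f t - f s = integral {s..t} F"
proof -
  have "integral {a..s} F + integral {s..t} F = integral {a..t} F"
    by (rule Henstock_Kurzweil_Integration.integral_combine)
      (use assms primitive_on_integrable[OF p, of a t] in auto)
  moreover have "f t = f a + integral {a..t} F" "f s = f a + integral {a..s} F"
    by (rule primitive_onD[OF p]; use assms in simp)+
  ultimately show ?thesis by (metis add_diff_cancel_left add_diff_cancel_left')
qed

lemma norm_integral_le_length:
  fixes f :: "real \<Rightarrow> complex"
  assumes "s \<le> t" "f integrable_on {s..t}" "\<And>r. r \<in> {s..t} \<Longrightarrow> norm (f r) \<le> B" "0 \<le> B"
  shows "norm (integral {s..t} f) \<le> B * (t - s)"
  using has_integral_bound_real[of B "{}" f "integral {s..t} f" s t] assms
  by (simp add: integrable_integral)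

lemma primitive_on_lipschitz:
  assumes p: "primitive_on a b f F"
  obtains B where "0 < B" "\<forall>s\<in>{a..b}. norm (F s) \<le> B" "\<And>s t. s \<in> {a..b} \<Longrightarrow> t \<in> {a..b} \<Longrightarrow> norm (f t - f s) \<le> B * \<bar>t - s\<bar>"
proof -
  obtain B0 where B0: "\<forall>s\<in>{a..b}. norm (F s) \<le> B0" using p unfolding primitive_on_def by auto
  define B where "B = max B0 1"
  have B: "\<forall>s\<in>{a..b}. norm (F s) \<le> B" "0 < B" using B0 unfolding B_def by fastforce+
  have *: "norm (f t - f s) \<le> B * \<bar>t - s\<bar>" if "a \<le> s" "s \<le> t" "t \<le> b" for s t
  proof -
    have "norm (integral {s..t} F) \<le> B * (t - s)"
      by (rule norm_integral_le_length) (use B that primitive_on_integrable[OF p, of s t] in auto)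
    then show ?thesis using primitive_on_diff[OF p that] that by simp
  qed
  show ?thesis
  proof (rule that[OF B(2) B(1)])
    fix s t assume "s \<in> {a..b}" "t \<in> {a..b}"
    then show "norm (f t - f s) \<le> B * \<bar>t - s\<bar>"
      using *[of s t] *[of t s] by (cases "s \<le> t") (auto simp: norm_minus_commute)
  qed
qed

lemma primitive_on_continuous:
  assumes p: "primitive_on a b f F"
  shows "continuous_on {a..b} f"
proof -
  have "continuous_on {a..b} (\<lambda>t. f a + integral {a..t} F)"
    by (intro continuous_intros indefinite_integral_continuous_1 primitive_on_integrable[OF p]) simp
  moreover have "continuous_on {a..b} (\<lambda>t. f a + integral {a..t} F) = continuous_on {a..b} f"
    by (rule continuous_on_cong) (use p in \<open>simp_all only: primitive_on_def\<close>)
  ultimately show ?thesis by simp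
qed

lemma primitive_onI:
  assumes "F \<in> borel_measurable (lebesgue_on {a..b})" "\<And>s. s \<in> {a..b} \<Longrightarrow> norm (F s) \<le> B"
    "\<And>t. t \<in> {a..b} \<Longrightarrow> f t = f a + integral {a..t} F"
  shows "primitive_on a b f F"
  using assms unfolding primitive_on_def by blast

lemma measurable_continuous_interval:
  fixes g :: "real \<Rightarrow> complex"
  assumes "continuous_on {a..b} g"
  shows "g \<in> borel_measurable (lebesgue_on {a..b})"
  by (rule continuous_imp_measurable_on_sets_lebesgue[OF assms]) simp

lemma continuous_bounded_interval:
  fixes g :: "real \<Rightarrow> complex"
  assumes "continuous_on {a..b} g"
  obtains B where "0 < B" "\<And>s. s \<in> {a..b} \<Longrightarrow> norm (g s) \<le> B"
proof -
  have "bounded (g ` {a..b})"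
    using assms compact_continuous_image compact_imp_bounded by blast
  then show ?thesis using that by (auto simp: bounded_pos)
qed

text \<open>Although f need not be differentiable at a given point, the difference of the two sides
of the integrated chain rule is differentiable everywhere, with derivative 0: near s the
increment of \<open>\<phi> \<circ> f\<close> is \<phi>'(f s) times the increment of f, up to an error that is small against
the increment of f and hence, f being Lipschitz, small against the increment of time; the
integral of \<phi>'(f) F has the same expansion by continuity of \<phi>' and boundedness of F.\<close>

lemma primitive_on_chain:
  fixes \<phi> :: "complex \<Rightarrow> complex"
  assumes p: "primitive_on a b f F"
    and der: "\<And>s. s \<in> {a..b} \<Longrightarrow> (\<phi> has_field_derivative \<phi>' (f s)) (at (f s))"
    and cont: "continuous_on (f ` {a..b}) \<phi>'"
  shows "primitive_on a b (\<lambda>s. \<phi> (f s)) (\<lambda>s. \<phi>' (f s) * F s)"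
proof -
  let ?H = "\<lambda>s. \<phi>' (f s) * F s"
  obtain B where B: "0 < B" "\<forall>s\<in>{a..b}. norm (F s) \<le> B"
      "\<And>s t. s \<in> {a..b} \<Longrightarrow> t \<in> {a..b} \<Longrightarrow> norm (f t - f s) \<le> B * \<bar>t - s\<bar>"
    using primitive_on_lipschitz[OF p] by blast
  have cf: "continuous_on {a..b} f" by (rule primitive_on_continuous[OF p])
  have c': "continuous_on {a..b} (\<lambda>s. \<phi>' (f s))"
    using continuous_on_compose[OF cf cont] by (simp add: o_def)
  have Hm: "?H \<in> borel_measurable (lebesgue_on {a..b})"
    using p measurable_continuous_interval[OF c'] unfolding primitive_on_def
    by (intro borel_measurable_times) auto
  obtain C where C: "0 < C" "\<And>s. s \<in> {a..b} \<Longrightarrow> norm (\<phi>' (f s)) \<le> C"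
    using continuous_bounded_interval[OF c'] by blast
  have Hb: "\<forall>s\<in>{a..b}. norm (?H s) \<le> C * B"
    using B C by (auto simp: norm_mult intro!: mult_mono)
  have Hi: "?H integrable_on {c..d}" if "{c..d} \<subseteq> {a..b}" for c d
    using bounded_measurable_imp_absolutely_integrable[OF Hm Hb that] set_lebesgue_integral_eq_integral(1) by blast
  define D where "D t = \<phi> (f t) - integral {a..t} ?H" for t
  have c\<phi>: "continuous_on {a..b} (\<lambda>s. \<phi> (f s))"
  proof (rule continuous_on_compose2[OF _ cf])
    show "continuous_on (f ` {a..b}) \<phi>"
      by (rule continuous_at_imp_continuous_on) (use der DERIV_isCont in blast)
  qed simp
  have cD: "continuous_on {a..b} D"
    unfolding D_def by (intro continuous_intros c\<phi> indefinite_integral_continuous_1 Hi) simp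
  \<comment> \<open>The defect D of the chain rule has derivative 0, hence is constant.\<close>
  have derD: "(D has_derivative (\<lambda>h. 0)) (at s within {a..b})" if s: "s \<in> {a..b}" for s
    unfolding has_derivative_within_alt
  proof (intro conjI allI impI)
    show "bounded_linear (\<lambda>h::real. 0::complex)" by simp
    fix e :: real assume e: "0 < e"
    \<comment> \<open>The expansion of \<phi> and the oscillation of \<phi>' each contribute \<open>e' * B = e / 2\<close> per unit of time.\<close>
    define e' where "e' = e / (2 * B)"
    have e': "0 < e'" using e B(1) by (simp add: e'_def)
    obtain d1 where d1: "0 < d1" "\<And>z. norm (z - f s) < d1 \<Longrightarrow>
        norm (\<phi> z - \<phi> (f s) - \<phi>' (f s) * (z - f s)) \<le> e' * norm (z - f s)"
      using der[OF s] e' unfolding has_field_derivative_def has_derivative_within_alt by fastforce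
    obtain d2 where d2: "0 < d2" "\<And>r. r \<in> {a..b} \<Longrightarrow> \<bar>r - s\<bar> < d2 \<Longrightarrow> norm (\<phi>' (f r) - \<phi>' (f s)) < e'"
      using c' s e' unfolding continuous_on_iff dist_norm by fastforce
    define d where "d = min (d1 / B) d2"
    have d: "0 < d" using d1 d2 B by (simp add: d_def)
    have piece: "norm (integral {u..v} ?H - \<phi>' (f s) * (f v - f u)) \<le> e' * B * (v - u)"
      if uv: "a \<le> u" "u \<le> v" "v \<le> b" "\<bar>u - s\<bar> < d" "\<bar>v - s\<bar> < d" for u v
    proof -
      have i: "?H integrable_on {u..v}" "F integrable_on {u..v}"
        using uv Hi primitive_on_integrable[OF p] by auto
      have "integral {u..v} ?H - \<phi>' (f s) * (f v - f u) = integral {u..v} (\<lambda>r. ?H r - \<phi>' (f s) * F r)"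
        using i uv by (simp add: integral_diff integrable_on_mult_right primitive_on_diff[OF p])
      moreover have "norm (integral {u..v} (\<lambda>r. ?H r - \<phi>' (f s) * F r)) \<le> (e' * B) * (v - u)"
      proof (rule norm_integral_le_length)
        show "(\<lambda>r. ?H r - \<phi>' (f s) * F r) integrable_on {u..v}"
          by (intro integrable_diff i integrable_on_mult_right)
        show "norm (?H r - \<phi>' (f s) * F r) \<le> e' * B" if "r \<in> {u..v}" for r
        proof -
          have "norm (\<phi>' (f r) - \<phi>' (f s)) \<le> e'" "norm (F r) \<le> B"
            using that uv less_imp_le[OF d2(2)[of r]] B(2) by (auto simp: d_def)
          then have "norm ((\<phi>' (f r) - \<phi>' (f s)) * F r) \<le> e' * B"
            unfolding norm_mult by (intro mult_mono) (use e' in auto)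
          then show ?thesis by (simp add: algebra_simps)
        qed
      qed (use e' B uv in auto)
      ultimately show ?thesis by simp
    qed
    have "norm (D t - D s) \<le> e * norm (t - s)" if t: "t \<in> {a..b}" "norm (t - s) < d" for t
    proof -
      define J where "J = integral {a..t} ?H - integral {a..s} ?H"
      have comb: "integral {a..u} ?H + integral {u..v} ?H = integral {a..v} ?H"
        if "a \<le> u" "u \<le> v" "v \<le> b" for u v
        by (rule Henstock_Kurzweil_Integration.integral_combine) (use that Hi in auto)
      have J: "norm (J - \<phi>' (f s) * (f t - f s)) \<le> e' * B * \<bar>t - s\<bar>"
      proof (cases "s \<le> t")
        case True
        then have "J = integral {s..t} ?H" using comb[of s t] s t by (simp add: J_def algebra_simps)
        then show ?thesis using piece[of s t] True s t d by auto
      next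
        case False
        then have "J = - integral {t..s} ?H" using comb[of t s] s t by (simp add: J_def algebra_simps)
        then have "J - \<phi>' (f s) * (f t - f s) = - (integral {t..s} ?H - \<phi>' (f s) * (f s - f t))"
          by (simp add: algebra_simps)
        then have "norm (J - \<phi>' (f s) * (f t - f s)) = norm (integral {t..s} ?H - \<phi>' (f s) * (f s - f t))"
          by (metis norm_minus_cancel)
        moreover have "norm (integral {t..s} ?H - \<phi>' (f s) * (f s - f t)) \<le> e' * B * (s - t)"
          by (rule piece) (use False s t d in auto)
        moreover have "\<bar>t - s\<bar> = s - t" using False by simp
        ultimately show ?thesis by simp
      qed
      have "norm (f t - f s) \<le> B * \<bar>t - s\<bar>" using B s t by blast
      moreover have "B * \<bar>t - s\<bar> < d1" using t B by (auto simp: d_def field_simps)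
      ultimately have "norm (\<phi> (f t) - \<phi> (f s) - \<phi>' (f s) * (f t - f s)) \<le> e' * norm (f t - f s)"
        by (intro d1) auto
      also have "\<dots> \<le> e' * (B * \<bar>t - s\<bar>)" using B s t e' by (intro mult_left_mono) auto
      finally have I: "norm (\<phi> (f t) - \<phi> (f s) - \<phi>' (f s) * (f t - f s)) \<le> e' * B * \<bar>t - s\<bar>" by simp
      have "D t - D s = (\<phi> (f t) - \<phi> (f s) - \<phi>' (f s) * (f t - f s)) - (J - \<phi>' (f s) * (f t - f s))"
        by (simp add: D_def J_def)
      also have "norm \<dots> \<le> e' * B * \<bar>t - s\<bar> + e' * B * \<bar>t - s\<bar>"
        using I J norm_triangle_ineq4 by (smt (verit))
      also have "\<dots> = e * norm (t - s)" using B by (simp add: e'_def)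
      finally show ?thesis .
    qed
    then show "\<exists>d>0. \<forall>t\<in>{a..b}. norm (t - s) < d \<longrightarrow> norm (D t - D s - 0) \<le> e * norm (t - s)"
      using d by auto
  qed
  have Dconst: "D t = D a" if "t \<in> {a..b}" for t
    by (rule has_derivative_zero_unique_strong_interval[of "{}" a b D]) (use cD derD that in auto)
  have val: "\<phi> (f t) = \<phi> (f a) + integral {a..t} ?H" if "t \<in> {a..b}" for t
    using Dconst[OF that] by (simp add: D_def diff_eq_eq)
  show ?thesis
    by (rule primitive_onI[OF Hm Hb[rule_format] val])
qed

lemma primitive_on_cong:
  assumes p: "primitive_on a b f F"
    and eq: "\<And>s. s \<in> {a..b} \<Longrightarrow> g s = f s" "\<And>s. s \<in> {a..b} \<Longrightarrow> G s = F s"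
  shows "primitive_on a b g G"
proof -
  obtain B where B: "F \<in> borel_measurable (lebesgue_on {a..b})" "\<And>s. s \<in> {a..b} \<Longrightarrow> norm (F s) \<le> B"
    using p unfolding primitive_on_def by blast
  show ?thesis
  proof (rule primitive_onI)
    show "G \<in> borel_measurable (lebesgue_on {a..b})"
      using B(1) by (rule measurable_cong[THEN iffD1, rotated]) (simp add: eq)
    show "norm (G s) \<le> B" if "s \<in> {a..b}" for s using B that eq by simp
    fix t assume t: "t \<in> {a..b}"
    have "integral {a..t} G = integral {a..t} F"
      by (rule integral_cong) (use t eq in auto)
    moreover have "a \<in> {a..b}" using t by simp
    ultimately show "g t = g a + integral {a..t} G"
      using primitive_onD[OF p t] eq(1)[OF t] eq(1)[of a] by metis
  qed
qed

lemma primitive_on_add: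
  assumes p: "primitive_on a b f F" "primitive_on a b g G"
  shows "primitive_on a b (\<lambda>s. f s + g s) (\<lambda>s. F s + G s)"
proof -
  obtain B where B: "F \<in> borel_measurable (lebesgue_on {a..b})" "\<And>s. s \<in> {a..b} \<Longrightarrow> norm (F s) \<le> B"
    using p unfolding primitive_on_def by blast
  obtain C where C: "G \<in> borel_measurable (lebesgue_on {a..b})" "\<And>s. s \<in> {a..b} \<Longrightarrow> norm (G s) \<le> C"
    using p unfolding primitive_on_def by blast
  show ?thesis
  proof (rule primitive_onI)
    show "(\<lambda>s. F s + G s) \<in> borel_measurable (lebesgue_on {a..b})"
      using B(1) C(1) by (rule borel_measurable_add)
    show "norm (F s + G s) \<le> B + C" if "s \<in> {a..b}" for s
      using B(2)[OF that] C(2)[OF that] norm_triangle_ineq[of "F s" "G s"] by linarith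
    fix t assume t: "t \<in> {a..b}"
    have "integral {a..t} (\<lambda>s. F s + G s) = integral {a..t} F + integral {a..t} G"
      by (rule integral_add) (use t primitive_on_integrable[OF p(1), of a t] primitive_on_integrable[OF p(2), of a t] in auto)
    with primitive_onD[OF p(1) t] primitive_onD[OF p(2) t]
    show "f t + g t = f a + g a + integral {a..t} (\<lambda>s. F s + G s)"
      by (metis (no_types, lifting) add.commute add.left_commute)
  qed
qed

lemma primitive_on_cmult:
  assumes p: "primitive_on a b f F"
  shows "primitive_on a b (\<lambda>s. c * f s) (\<lambda>s. c * F s)"
  using primitive_on_chain[OF p, of "\<lambda>z. c * z" "\<lambda>_. c"]
  by (auto intro!: derivative_eq_intros)

lemma primitive_on_minus:
  assumes p: "primitive_on a b f F"
  shows "primitive_on a b (\<lambda>s. - f s) (\<lambda>s. - F s)"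
  using primitive_on_cmult[OF p, of "-1"] by simp

text \<open>The product rule is the chain rule for the square, by polarisation.\<close>

lemma primitive_on_mult:
  assumes p: "primitive_on a b f F" "primitive_on a b g G"
  shows "primitive_on a b (\<lambda>s. f s * g s) (\<lambda>s. F s * g s + f s * G s)"
proof -
  have sq: "primitive_on a b (\<lambda>s. (h s)\<^sup>2) (\<lambda>s. 2 * h s * H s)" if "primitive_on a b h H" for h H
    by (rule primitive_on_chain[OF that, where \<phi>' = "\<lambda>z. 2 * z"])
      (auto intro!: derivative_eq_intros continuous_intros)
  have "primitive_on a b (\<lambda>s. 1/2 * ((f s + g s)\<^sup>2 + - ((f s)\<^sup>2 + (g s)\<^sup>2)))
     (\<lambda>s. 1/2 * (2 * (f s + g s) * (F s + G s) + - (2 * f s * F s + 2 * g s * G s)))"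
    by (intro primitive_on_cmult primitive_on_add primitive_on_minus sq p)
  then show ?thesis
    by (rule primitive_on_cong) (auto simp: power2_eq_square field_simps)
qed

lemma primitive_on_inverse:
  assumes p: "primitive_on a b f F" and "\<And>s. s \<in> {a..b} \<Longrightarrow> f s \<noteq> 0"
  shows "primitive_on a b (\<lambda>s. inverse (f s)) (\<lambda>s. - F s / (f s)\<^sup>2)"
proof -
  have "primitive_on a b (\<lambda>s. inverse (f s)) (\<lambda>s. - (inverse (f s))\<^sup>2 * F s)"
    by (rule primitive_on_chain[OF p, where \<phi>' = "\<lambda>z. - (inverse z)\<^sup>2"])
      (use assms(2) in \<open>auto intro!: derivative_eq_intros continuous_intros simp: power2_eq_square\<close>)
  then show ?thesis by (rule primitive_on_cong) (auto simp: power_inverse divide_inverse)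
qed

lemma primitive_on_exp:
  assumes p: "primitive_on a b f F"
  shows "primitive_on a b (\<lambda>s. exp (f s)) (\<lambda>s. exp (f s) * F s)"
  by (rule primitive_on_chain[OF p]) (auto intro!: derivative_eq_intros continuous_intros)

lemma primitive_on_subinterval:
  assumes p: "primitive_on a b f F" and "{c..d} \<subseteq> {a..b}"
  shows "primitive_on c d f F"
proof -
  obtain B where B: "F \<in> borel_measurable (lebesgue_on {a..b})" "\<And>s. s \<in> {a..b} \<Longrightarrow> norm (F s) \<le> B"
    using p unfolding primitive_on_def by blast
  show ?thesis
  proof (rule primitive_onI)
    show "F \<in> borel_measurable (lebesgue_on {c..d})"
      by (rule measurable_restrict_mono[OF B(1) assms(2)])
    show "norm (F s) \<le> B" if "s \<in> {c..d}" for s using that B assms(2) by blast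
    fix t assume t: "t \<in> {c..d}"
    then have "c \<in> {a..b}" "d \<in> {a..b}" using assms(2) by auto
    then show "f t = f c + integral {c..t} F"
      using primitive_on_diff[OF p, of c t] t by (metis add_diff_cancel_left' atLeastAtMost_iff diff_add_cancel add.commute order_trans)
  qed
qed

lemma primitive_on_indefinite_integral:
  assumes F: "F \<in> borel_measurable (lebesgue_on {a..b})" "\<And>s. s \<in> {a..b} \<Longrightarrow> norm (F s) \<le> B"
  shows "primitive_on a b (\<lambda>t. integral {a..t} F) F"
  by (rule primitive_onI[OF F]) auto

lemma primitive_on_indefinite_integral_continuous:
  assumes F: "continuous_on {a..b} F"
  shows "primitive_on a b (\<lambda>t. integral {a..t} F) F"
  using continuous_bounded_interval[OF F] measurable_continuous_interval[OF F] primitive_on_indefinite_integral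
  by metis

lemma primitive_on_has_vector_derivative:
  assumes p: "primitive_on a b f F" and F: "continuous_on {a..b} F" and t: "t \<in> {a..b}"
  shows "(f has_vector_derivative F t) (at t within {a..b})"
proof -
  have "((\<lambda>u. f a + integral {a..u} F) has_vector_derivative F t) (at t within {a..b})"
    using integral_has_vector_derivative[OF F t] by (auto intro!: derivative_eq_intros)
  then show ?thesis
    by (rule has_vector_derivative_transform[OF t, rotated]) (rule primitive_onD[OF p])
qed

lemma primitive_on_of_vector_derivative:
  assumes "\<And>t. t \<in> {a..b} \<Longrightarrow> (f has_vector_derivative F t) (at t within {a..b})"
    and F: "continuous_on {a..b} F"
  shows "primitive_on a b f F"
proof -
  obtain B where B: "\<And>s. s \<in> {a..b} \<Longrightarrow> norm (F s) \<le> B"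
    using continuous_bounded_interval[OF F] by blast
  show ?thesis
  proof (rule primitive_onI[OF measurable_continuous_interval[OF F] B])
    fix t assume t: "t \<in> {a..b}"
    have "(F has_integral (f t - f a)) {a..t}"
      by (rule fundamental_theorem_of_calculus)
        (use t assms(1) has_vector_derivative_within_subset[of f _ _ "{a..b}" "{a..t}"] in auto)
    then show "f t = f a + integral {a..t} F" by (simp add: integral_unique)
  qed
qed

lemma primitive_on_glue:
  assumes p: "primitive_on a b f F" "primitive_on b c f F" and "a \<le> b" "b \<le> c"
  shows "primitive_on a c f F"
proof -
  obtain B where B: "F \<in> borel_measurable (lebesgue_on {a..b})" "\<And>s. s \<in> {a..b} \<Longrightarrow> norm (F s) \<le> B"
    using p unfolding primitive_on_def by blast
  obtain C where C: "F \<in> borel_measurable (lebesgue_on {b..c})" "\<And>s. s \<in> {b..c} \<Longrightarrow> norm (F s) \<le> C"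
    using p unfolding primitive_on_def by blast
  have m: "F \<in> borel_measurable (lebesgue_on {a..c})"
  proof (rule measurable_piecewise_restrict[where C="{{a..b},{b..c}}"])
    fix \<Omega> :: "real set" assume \<Omega>: "\<Omega> \<in> {{a..b},{b..c}}"
    then have "\<Omega> \<subseteq> {a..c}" using assms by auto
    then show "\<Omega> \<inter> space (lebesgue_on {a..c}) \<in> sets (lebesgue_on {a..c})"
      using \<Omega> by (auto simp: sets_restrict_space_iff Int_absorb2)
    have "restrict_space (lebesgue_on {a..c}) \<Omega> = lebesgue_on \<Omega>"
      using \<Omega> \<open>\<Omega> \<subseteq> {a..c}\<close> by (subst restrict_restrict_space) (auto simp: Int_absorb1)
    then show "F \<in> borel_measurable (restrict_space (lebesgue_on {a..c}) \<Omega>)"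
      using \<Omega> B C by auto
  qed auto
  have bd: "norm (F s) \<le> max B C" if "s \<in> {a..c}" for s
    using B(2)[of s] C(2)[of s] that by (cases "s \<le> b") auto
  show ?thesis
  proof (rule primitive_onI[OF m bd])
    fix t assume t: "t \<in> {a..c}"
    show "f t = f a + integral {a..t} F"
    proof (cases "t \<le> b")
      case True
      then show ?thesis using primitive_onD[OF p(1), of t] t by simp
    next
      case False
      have "F integrable_on {a..t}"
        using bounded_measurable_imp_absolutely_integrable[OF m, of "max B C" a t] bd t
          set_lebesgue_integral_eq_integral(1) by fastforce
      then have "integral {a..b} F + integral {b..t} F = integral {a..t} F"
        by (intro Henstock_Kurzweil_Integration.integral_combine) (use assms False t in auto)
      moreover have "f b = f a + integral {a..b} F"
        by (rule primitive_onD[OF p(1)]) (use assms in simp)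
      moreover have "f t = f b + integral {b..t} F"
        by (rule primitive_onD[OF p(2)]) (use assms t False in simp)
      ultimately show ?thesis by (metis add.assoc)
    qed
  qed
qed

section \<open>Controls\<close>

text \<open>Representatives of controls that are Borel measurable, so that they can be composed with affine
changes of time, and that satisfy the bounds everywhere.\<close>

definition regular_control :: "real \<Rightarrow> real \<Rightarrow> (real \<Rightarrow> real) \<Rightarrow> bool" where
  "regular_control n1 n2 \<epsilon> \<longleftrightarrow> \<epsilon> \<in> borel_measurable borel \<and> (\<forall>s. n1\<^sup>2 \<le> \<epsilon> s \<and> \<epsilon> s \<le> n2\<^sup>2)"

lemma regular_control_feasible:
  assumes "regular_control n1 n2 \<epsilon>"
  shows "\<epsilon> \<in> feasible n1 n2 I"
proof -
  have "\<epsilon> \<in> borel_measurable lebesgue"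
    using assms by (auto simp: regular_control_def intro: measurable_completion)
  then have "\<epsilon> \<in> borel_measurable (lebesgue_on I)" by (rule measurable_restrict_space1)
  then show ?thesis using assms by (auto simp: feasible_def regular_control_def)
qed

text \<open>A Lebesgue measurable function agrees almost everywhere with a Borel function, and clamping
this function to the admissible interval changes it on a null set only.\<close>

lemma feasible_regularize:
  assumes f: "\<epsilon> \<in> feasible n1 n2 I" and I: "I \<in> sets lebesgue" "{a<..<b} \<subseteq> I" and "n1\<^sup>2 \<le> n2\<^sup>2"
  obtains \<epsilon>' N where "regular_control n1 n2 \<epsilon>'" "negligible N" "\<And>s. s \<in> {a..b} - N \<Longrightarrow> \<epsilon> s = \<epsilon>' s"
proof -
  have m: "\<epsilon> \<in> borel_measurable (lebesgue_on I)" and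
    ae: "AE s in lebesgue_on I. n1\<^sup>2 \<le> \<epsilon> s \<and> \<epsilon> s \<le> n2\<^sup>2"
    using f unfolding feasible_def by auto
  have "(\<lambda>s. if s \<in> I then \<epsilon> s else 0) \<in> borel_measurable lebesgue"
    using m I(1) by (simp add: borel_measurable_if)
  then obtain g where g: "g \<in> borel_measurable lborel" "AE s in lborel. (if s \<in> I then \<epsilon> s else 0) = g s"
    using completion_ex_borel_measurable_real by blast
  define \<epsilon>' where "\<epsilon>' s = max (n1\<^sup>2) (min (n2\<^sup>2) (g s))" for s
  have "(\<lambda>s. max (n1\<^sup>2) (min (n2\<^sup>2) (g s))) \<in> borel_measurable borel"
    using g(1) by simp
  then have r: "regular_control n1 n2 \<epsilon>'"
    using assms(4) unfolding regular_control_def \<epsilon>'_def[abs_def] by auto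
  have "AE s in lebesgue. s \<in> I \<longrightarrow> n1\<^sup>2 \<le> \<epsilon> s \<and> \<epsilon> s \<le> n2\<^sup>2"
    using ae I(1) by (subst (asm) AE_restrict_space_iff) auto
  moreover have "AE s in lebesgue. (if s \<in> I then \<epsilon> s else 0) = g s"
    using g(2) by (rule AE_completion)
  ultimately have "AE s in lebesgue. s \<in> I \<longrightarrow> \<epsilon> s = \<epsilon>' s"
    by eventually_elim (auto simp: \<epsilon>'_def)
  then obtain M where M: "M \<in> null_sets lebesgue" "{s \<in> space lebesgue. \<not> (s \<in> I \<longrightarrow> \<epsilon> s = \<epsilon>' s)} \<subseteq> M"
    unfolding eventually_ae_filter by blast
  show ?thesis
  proof (rule that[OF r])
    \<comment> \<open>The end points need not belong to I, so they are put into the exceptional set.\<close>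
    show "negligible (M \<union> {a,b})"
      using M(1) by (simp add: negligible_iff_null_sets)
    show "\<epsilon> s = \<epsilon>' s" if "s \<in> {a..b} - (M \<union> {a,b})" for s
    proof -
      have "s \<in> {a<..<b}" using that by auto
      then have "s \<in> I" using I(2) by blast
      then show ?thesis using that M(2) by auto
    qed
  qed
qed

lemma regular_control_measurable:
  assumes "regular_control n1 n2 \<epsilon>"
  shows "(\<lambda>s. complex_of_real (\<epsilon> s)) \<in> borel_measurable (lebesgue_on {a..b})"
proof -
  have "\<epsilon> \<in> borel_measurable (lebesgue_on {a..b})"
    using regular_control_feasible[OF assms] by (simp add: feasible_def)
  then show ?thesis by measurable
qed

lemma regular_control_norm_le:
  assumes "regular_control n1 n2 \<epsilon>"
  shows "norm (complex_of_real (\<epsilon> s)) \<le> n2\<^sup>2"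
  using assms unfolding regular_control_def norm_of_real
  by (smt (verit) zero_le_power2)

lemma control_mult_measurable_bounded:
  assumes "regular_control n1 n2 \<epsilon>" and g: "continuous_on {a..b} g"
  shows "(\<lambda>s. complex_of_real (\<epsilon> s) * g s) \<in> borel_measurable (lebesgue_on {a..b})"
    and "\<exists>B. \<forall>s\<in>{a..b}. norm (complex_of_real (\<epsilon> s) * g s) \<le> B"
proof -
  show "(\<lambda>s. complex_of_real (\<epsilon> s) * g s) \<in> borel_measurable (lebesgue_on {a..b})"
    by (intro borel_measurable_times regular_control_measurable[OF assms(1)] measurable_continuous_interval[OF g])
  obtain C where C: "0 < C" "\<And>s. s \<in> {a..b} \<Longrightarrow> norm (g s) \<le> C"
    using continuous_bounded_interval[OF g] by blast
  have "norm (complex_of_real (\<epsilon> s) * g s) \<le> n2\<^sup>2 * C" if "s \<in> {a..b}" for s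
    unfolding norm_mult using C(2)[OF that] C(1) regular_control_norm_le[OF assms(1), of s]
    by (intro mult_mono) auto
  then show "\<exists>B. \<forall>s\<in>{a..b}. norm (complex_of_real (\<epsilon> s) * g s) \<le> B" by blast
qed

text \<open>The equation of y' and the control system in either chart have a right-hand side of this
form, affine in the control with coefficients that are continuous along a solution.\<close>

lemma affine_control_primitive_iff:
  assumes r: "regular_control n1 n2 \<epsilon>" and g: "continuous_on {a..b} g" and h: "continuous_on {a..b} h"
    and F: "\<And>s. s \<in> {a..b} \<Longrightarrow> F s (f s) = g s + of_real (\<epsilon> s) * h s"
  shows "caratheodory_solution F a b f \<longleftrightarrow> primitive_on a b f (\<lambda>s. g s + of_real (\<epsilon> s) * h s)"
proof -
  let ?G = "\<lambda>s. g s + of_real (\<epsilon> s) * h s"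
  obtain B where B: "\<And>s. s \<in> {a..b} \<Longrightarrow> norm (g s) \<le> B"
    using continuous_bounded_interval[OF g] by blast
  obtain C where C: "\<And>s. s \<in> {a..b} \<Longrightarrow> norm (of_real (\<epsilon> s) * h s) \<le> C"
    using control_mult_measurable_bounded(2)[OF r h] by blast
  have bd: "\<forall>s\<in>{a..b}. norm (?G s) \<le> B + C"
    using norm_triangle_mono[OF B C] by blast
  have m: "?G \<in> borel_measurable (lebesgue_on {a..b})"
    by (intro borel_measurable_add measurable_continuous_interval[OF g] control_mult_measurable_bounded(1)[OF r h])
  have ai: "?G absolutely_integrable_on {a..b}"
    by (rule bounded_measurable_imp_absolutely_integrable[OF m bd]) simp
  have "(\<lambda>s. F s (f s)) absolutely_integrable_on {a..b}"
    using ai by (rule absolutely_integrable_spike[of _ _ "{}"]) (use F in auto)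
  moreover have "integral {a..t} (\<lambda>s. F s (f s)) = integral {a..t} ?G" if "t \<in> {a..b}" for t
    by (rule integral_cong) (use that F in auto)
  ultimately show ?thesis
    unfolding caratheodory_solution_def primitive_on_def using m bd by auto
qed

lemma caratheodory_solution_cong_ae:
  assumes "negligible N" "\<And>s. s \<in> {a..b} - N \<Longrightarrow> F s (f s) = G s (f s)"
  shows "caratheodory_solution F a b f \<longleftrightarrow> caratheodory_solution G a b f"
proof -
  have "(\<lambda>s. F s (f s)) absolutely_integrable_on {a..b} \<longleftrightarrow> (\<lambda>s. G s (f s)) absolutely_integrable_on {a..b}"
    by (rule iffI; erule absolutely_integrable_spike[OF _ assms(1)]) (use assms(2) in auto)
  moreover have "integral {a..t} (\<lambda>s. F s (f s)) = integral {a..t} (\<lambda>s. G s (f s))" if "t \<in> {a..b}" for t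
    by (rule integral_spike[OF assms(1)]) (use that assms(2) in auto)
  ultimately show ?thesis unfolding caratheodory_solution_def by auto
qed

section \<open>Growth of solutions of integral inequalities\<close>

text \<open>The product of \<open>exp (- K v)\<close> and g s + K times the integral of g over [s, v] does not increase
in v.\<close>

lemma gronwall_forward:
  fixes g :: "real \<Rightarrow> real"
  assumes cont: "continuous_on {a..b} g" and "0 \<le> K" and st: "a \<le> s" "s \<le> t" "t \<le> b"
    and le: "\<And>u v. a \<le> u \<Longrightarrow> u \<le> v \<Longrightarrow> v \<le> b \<Longrightarrow> g v \<le> g u + K * integral {u..v} g"
  shows "g t \<le> g s * exp (K * (t - s))"
proof -
  define G where "G v = g s + K * integral {s..v} g" for v
  have cs: "continuous_on {s..t} g" using cont by (rule continuous_on_subset) (use st in auto)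
  have "continuous_on {s..t} G"
    unfolding G_def by (intro continuous_intros indefinite_integral_continuous_1 integrable_continuous_interval cs)
  moreover have gG: "g v \<le> G v" if "v \<in> {s..t}" for v
    using le[of s v] that st by (auto simp: G_def)
  have "exp (- K * t) * G t \<le> exp (- K * s) * G s"
  proof (cases "s = t")
    case False
    show ?thesis
    proof (rule DERIV_nonpos_imp_decreasing_open[where f="\<lambda>v. exp (- K * v) * G v"])
      fix v assume v: "s < v" "v < t"
      have "((\<lambda>v. integral {s..v} g) has_real_derivative g v) (at v)"
        using integral_has_vector_derivative[OF cs, of v] v at_within_Icc_at[of s v t]
        by (simp add: has_real_derivative_iff_has_vector_derivative)
      then have "(G has_real_derivative K * g v) (at v)"
        unfolding G_def by (auto intro!: derivative_eq_intros)
      then have "((\<lambda>v. exp (- K * v) * G v) has_real_derivative exp (- K * v) * (K * g v - K * G v)) (at v)"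
        by (auto intro!: derivative_eq_intros simp: algebra_simps)
      moreover have "exp (- K * v) * (K * g v - K * G v) \<le> 0"
        using gG[of v] v \<open>0 \<le> K\<close> by (intro mult_nonneg_nonpos) (auto intro: mult_left_mono)
      ultimately show "\<exists>y. ((\<lambda>v. exp (- K * v) * G v) has_real_derivative y) (at v) \<and> y \<le> 0" by blast
    qed (use False st in \<open>auto intro!: continuous_intros calculation\<close>)
  qed simp
  then have "exp (K * t) * (exp (- K * t) * G t) \<le> exp (K * t) * (exp (- K * s) * g s)"
    by (simp add: G_def)
  moreover have "exp (K * t) * exp (- K * t) = 1" "exp (K * t) * exp (- K * s) = exp (K * (t - s))"
    by (simp_all add: exp_add[symmetric] right_diff_distrib)
  ultimately have "G t \<le> g s * exp (K * (t - s))"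
    by (metis mult.assoc mult.commute mult_1)
  then show ?thesis using gG[of t] st by simp
qed

text \<open>The two-sided version, obtained by reversing time, carries the information that a solution
vanishes at one instant to all earlier instants as well.\<close>

lemma gronwall:
  fixes g :: "real \<Rightarrow> real"
  assumes cont: "continuous_on {a..b} g" and "0 \<le> K" and st: "s \<in> {a..b}" "t \<in> {a..b}"
    and le: "\<And>u v. a \<le> u \<Longrightarrow> u \<le> v \<Longrightarrow> v \<le> b \<Longrightarrow> \<bar>g v - g u\<bar> \<le> K * integral {u..v} g"
  shows "g t \<le> g s * exp (K * \<bar>t - s\<bar>)"
proof (cases "s \<le> t")
  case True
  have "g t \<le> g s * exp (K * (t - s))"
    by (rule gronwall_forward[OF cont \<open>0 \<le> K\<close>]) (use True st le in \<open>auto simp: abs_le_iff algebra_simps\<close>)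
  then show ?thesis using True by simp
next
  case False
  have "g (- (- t)) \<le> g (- (- s)) * exp (K * (- t - - s))"
  proof (rule gronwall_forward[where a = "- b" and b = "- a" and g="\<lambda>r. g (- r)"])
    show "continuous_on {- b..- a} (\<lambda>r. g (- r))"
      by (rule continuous_on_compose2[OF cont]) (auto intro!: continuous_intros)
    fix u v assume uv: "- b \<le> u" "u \<le> v" "v \<le> - a"
    have "integral {u..v} (\<lambda>r. g (- r)) = integral {- v..- u} g"
      using Henstock_Kurzweil_Integration.integral_reflect_real[of "-u" "-v" g] by simp
    then show "g (- v) \<le> g (- u) + K * integral {u..v} (\<lambda>r. g (- r))"
      using le[of "- v" "- u"] uv by (auto simp: abs_le_iff algebra_simps)
  qed (use False st \<open>0 \<le> K\<close> in auto)
  then show ?thesis using False by simp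
qed

section \<open>The linear system\<close>

text \<open>The first-order form of y'' = - k^2 \<epsilon> y with w = y' / (i k). In contrast to
y' / (i k y), the ratio w / y in the boundary conditions makes sense for k = 0 as well, which
allows passing to the limit k = 0.\<close>

definition linear_system ::
    "complex \<Rightarrow> (real \<Rightarrow> real) \<Rightarrow> real \<Rightarrow> real \<Rightarrow> (real \<Rightarrow> complex) \<Rightarrow> (real \<Rightarrow> complex) \<Rightarrow> bool" where
  "linear_system k \<epsilon> a b y w \<longleftrightarrow>
    primitive_on a b y (\<lambda>s. \<i> * k * w s) \<and>
    primitive_on a b w (\<lambda>s. \<i> * k * of_real (\<epsilon> s) * y s)"

text \<open>The point of the sphere with homogeneous coordinates u and v.\<close>

definition ratio :: "complex \<Rightarrow> complex \<Rightarrow> sphere" where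
  "ratio u v = (if u = 0 then None else Some (v / u))"

text \<open>For nonzero k this says that k is an eigenvalue of \<epsilon> on [a, b], and also that \<epsilon> steers \<eta>1 to
\<eta>2 in time b - a under the spectral parameter k.\<close>

definition linked ::
    "complex \<Rightarrow> (real \<Rightarrow> real) \<Rightarrow> real \<Rightarrow> real \<Rightarrow> sphere \<Rightarrow> sphere \<Rightarrow> bool" where
  "linked k \<epsilon> a b \<eta>1 \<eta>2 \<longleftrightarrow>
    (\<exists>y w. linear_system k \<epsilon> a b y w \<and> (\<forall>s\<in>{a..b}. y s \<noteq> 0 \<or> w s \<noteq> 0) \<and>
      ratio (y a) (w a) = \<eta>1 \<and> ratio (y b) (w b) = \<eta>2)"

lemma linear_system_continuous:
  assumes "linear_system k \<epsilon> a b y w"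
  shows "continuous_on {a..b} y" "continuous_on {a..b} w"
  using assms unfolding linear_system_def by (auto intro: primitive_on_continuous)

text \<open>Both right-hand sides are bounded by a multiple of |y| + |w|, so Gronwall's inequality applies to
this sum.\<close>

lemma linear_system_growth:
  assumes sys: "linear_system k \<epsilon> a b y w" and r: "regular_control n1 n2 \<epsilon>"
    and st: "s \<in> {a..b}" "t \<in> {a..b}"
  shows "norm (y t) + norm (w t) \<le>
    (norm (y s) + norm (w s)) * exp (norm k * (1 + n2\<^sup>2) * \<bar>t - s\<bar>)"
proof (rule gronwall)
  note p = sys[unfolded linear_system_def]
  note c = linear_system_continuous[OF sys]
  have cn: "continuous_on {a..b} (\<lambda>t. norm (y t))" "continuous_on {a..b} (\<lambda>t. norm (w t))"
    using c by (auto intro: continuous_on_norm)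
  show "continuous_on {a..b} (\<lambda>t. norm (y t) + norm (w t))"
    by (intro continuous_intros cn)
  show "0 \<le> norm k * (1 + n2\<^sup>2)" by simp
  fix u v assume uv: "a \<le> u" "u \<le> v" "v \<le> b"
  have i: "(\<lambda>t. norm (y t)) integrable_on {u..v}" "(\<lambda>t. norm (w t)) integrable_on {u..v}"
    using uv by (auto intro!: integrable_continuous_interval continuous_on_subset[OF cn(1)] continuous_on_subset[OF cn(2)])
  have "norm (y v - y u) \<le> integral {u..v} (\<lambda>t. norm k * norm (w t))"
    unfolding primitive_on_diff[OF p[THEN conjunct1] uv]
    by (rule integral_norm_bound_integral)
      (use i uv primitive_on_integrable[OF p[THEN conjunct1], of u v] in \<open>auto simp: norm_mult intro: integrable_on_mult_right\<close>)
  moreover have "norm (w v - w u) \<le> integral {u..v} (\<lambda>t. norm k * (n2\<^sup>2 * norm (y t)))"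
    unfolding primitive_on_diff[OF p[THEN conjunct2] uv]
  proof (rule integral_norm_bound_integral)
    show "(\<lambda>s. \<i> * k * of_real (\<epsilon> s) * y s) integrable_on {u..v}"
      by (rule primitive_on_integrable[OF p[THEN conjunct2]]) (use uv in auto)
    show "norm (\<i> * k * of_real (\<epsilon> t) * y t) \<le> norm k * (n2\<^sup>2 * norm (y t))" for t
      using regular_control_norm_le[OF r, of t]
      unfolding norm_mult by (auto simp: mult.assoc intro!: mult_left_mono mult_right_mono)
  qed (use i in \<open>auto intro!: integrable_on_mult_right\<close>)
  moreover have "integral {u..v} (\<lambda>t. norm k * norm (w t)) + integral {u..v} (\<lambda>t. norm k * (n2\<^sup>2 * norm (y t)))
     = integral {u..v} (\<lambda>t. norm k * norm (w t) + norm k * (n2\<^sup>2 * norm (y t)))"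
    by (rule integral_add[symmetric]) (use i in \<open>auto intro!: integrable_on_mult_right\<close>)
  moreover have "\<dots> \<le> integral {u..v} (\<lambda>t. norm k * (1 + n2\<^sup>2) * (norm (y t) + norm (w t)))"
  proof (rule integral_le)
    show "norm k * norm (w t) + norm k * (n2\<^sup>2 * norm (y t)) \<le> norm k * (1 + n2\<^sup>2) * (norm (y t) + norm (w t))" for t
    proof -
      have "norm k * (1 + n2\<^sup>2) * (norm (y t) + norm (w t)) =
        norm k * norm (w t) + norm k * (n2\<^sup>2 * norm (y t)) + (norm k * norm (y t) + norm k * (n2\<^sup>2 * norm (w t)))"
        by (simp add: algebra_simps)
      then show ?thesis by simp
    qed
  qed (use i in \<open>auto intro!: integrable_add integrable_on_mult_right\<close>)
  moreover have "\<dots> = norm k * (1 + n2\<^sup>2) * integral {u..v} (\<lambda>t. norm (y t) + norm (w t))"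
    by simp
  ultimately show "\<bar>norm (y v) + norm (w v) - (norm (y u) + norm (w u))\<bar> \<le>
      norm k * (1 + n2\<^sup>2) * integral {u..v} (\<lambda>t. norm (y t) + norm (w t))"
    using norm_triangle_ineq3[of "y v" "y u"] norm_triangle_ineq3[of "w v" "w u"] by linarith
qed (use st in auto)

lemma linear_system_nonvanishing:
  assumes sys: "linear_system k \<epsilon> a b y w" and r: "regular_control n1 n2 \<epsilon>"
    and s: "s \<in> {a..b}" "y s \<noteq> 0 \<or> w s \<noteq> 0" and t: "t \<in> {a..b}"
  shows "y t \<noteq> 0 \<or> w t \<noteq> 0"
proof (rule ccontr)
  assume "\<not> ?thesis"
  then have "norm (y s) + norm (w s) \<le> 0"
    using linear_system_growth[OF sys r t s(1)] by simp
  then show False using s(2) by (smt (verit) norm_ge_zero zero_less_norm_iff)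
qed

lemma boundary_condition_iff_ratio:
  assumes "k \<noteq> 0"
  shows "boundary_condition k \<eta> u (\<i> * k * v) \<longleftrightarrow> ratio u v = \<eta>"
  using assms by (auto simp: boundary_condition_def ratio_def split: option.splits)

text \<open>Solutions correspond by w = y' / (i k). An eigenfunction that is nonzero somewhere gives a pair
that vanishes nowhere, by Gronwall's inequality; conversely, if y vanished identically, then so
would its derivative i k w.\<close>

lemma eigenvalue_iff_linked:
  assumes "a < b" and r: "regular_control n1 n2 \<epsilon>"
  shows "k \<in> eigenvalues a b \<eta>1 \<eta>2 \<epsilon> \<longleftrightarrow> k \<noteq> 0 \<and> linked k \<epsilon> a b \<eta>1 \<eta>2"
proof
  assume "k \<in> eigenvalues a b \<eta>1 \<eta>2 \<epsilon>"
  then obtain y v where k: "k \<noteq> 0" and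
    y: "\<And>s. s \<in> {a..b} \<Longrightarrow> (y has_vector_derivative v s) (at s within {a..b})" and
    v: "caratheodory_solution (\<lambda>s _. - k\<^sup>2 * of_real (\<epsilon> s) * y s) a b v" and
    nz: "\<exists>s\<in>{a..b}. y s \<noteq> 0" and
    bc: "boundary_condition k \<eta>1 (y a) (v a)" "boundary_condition k \<eta>2 (y b) (v b)"
    unfolding eigenvalues_def by blast
  have cy: "continuous_on {a..b} y"
    using y by (meson continuous_on_eq_continuous_within has_vector_derivative_continuous)
  have pv: "primitive_on a b v (\<lambda>s. 0 + of_real (\<epsilon> s) * (- k\<^sup>2 * y s))"
    using v by (subst (asm) affine_control_primitive_iff[OF r, of a b "\<lambda>_. 0" "\<lambda>s. - k\<^sup>2 * y s"])
      (auto intro!: continuous_intros cy)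
  define w where "w s = v s / (\<i> * k)" for s
  have vw: "v s = \<i> * k * w s" for s using k by (simp add: w_def)
  have "primitive_on a b (\<lambda>s. 1 / (\<i> * k) * v s) (\<lambda>s. 1 / (\<i> * k) * (0 + of_real (\<epsilon> s) * (- k\<^sup>2 * y s)))"
    by (rule primitive_on_cmult[OF pv])
  then have "primitive_on a b w (\<lambda>s. \<i> * k * of_real (\<epsilon> s) * y s)"
    by (rule primitive_on_cong) (use k in \<open>auto simp: w_def power2_eq_square field_simps\<close>)
  moreover have "primitive_on a b y (\<lambda>s. \<i> * k * w s)"
    unfolding vw[symmetric] by (rule primitive_on_of_vector_derivative[OF y primitive_on_continuous[OF pv]])
  ultimately have sys: "linear_system k \<epsilon> a b y w" by (simp add: linear_system_def)
  have "\<forall>s\<in>{a..b}. y s \<noteq> 0 \<or> w s \<noteq> 0"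
    using linear_system_nonvanishing[OF sys r] nz by blast
  moreover have "ratio (y a) (w a) = \<eta>1" "ratio (y b) (w b) = \<eta>2"
    using bc unfolding vw boundary_condition_iff_ratio[OF k] by auto
  ultimately show "k \<noteq> 0 \<and> linked k \<epsilon> a b \<eta>1 \<eta>2"
    unfolding linked_def using sys k by blast
next
  assume "k \<noteq> 0 \<and> linked k \<epsilon> a b \<eta>1 \<eta>2"
  then obtain y w where k: "k \<noteq> 0" and sys: "linear_system k \<epsilon> a b y w"
    and nz: "\<And>s. s \<in> {a..b} \<Longrightarrow> y s \<noteq> 0 \<or> w s \<noteq> 0"
    and ra: "ratio (y a) (w a) = \<eta>1" "ratio (y b) (w b) = \<eta>2"
    unfolding linked_def by auto
  note c = linear_system_continuous[OF sys]
  have y: "(y has_vector_derivative \<i> * k * w s) (at s within {a..b})" if "s \<in> {a..b}" for s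
    by (rule primitive_on_has_vector_derivative[OF _ _ that])
      (use sys in \<open>auto simp: linear_system_def intro!: continuous_intros c\<close>)
  have "primitive_on a b (\<lambda>s. \<i> * k * w s) (\<lambda>s. \<i> * k * (\<i> * k * of_real (\<epsilon> s) * y s))"
    by (rule primitive_on_cmult) (use sys in \<open>simp add: linear_system_def\<close>)
  then have "primitive_on a b (\<lambda>s. \<i> * k * w s) (\<lambda>s. 0 + of_real (\<epsilon> s) * (- k\<^sup>2 * y s))"
    by (rule primitive_on_cong) (auto simp: power2_eq_square algebra_simps)
  then have v: "caratheodory_solution (\<lambda>s _. - k\<^sup>2 * of_real (\<epsilon> s) * y s) a b (\<lambda>s. \<i> * k * w s)"
    by (subst affine_control_primitive_iff[OF r, of a b "\<lambda>_. 0" "\<lambda>s. - k\<^sup>2 * y s"])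
      (auto intro!: continuous_intros c)
  have "\<exists>s\<in>{a..b}. y s \<noteq> 0"
  proof (rule ccontr)
    assume "\<not> ?thesis"
    then have y0: "\<And>s. s \<in> {a..b} \<Longrightarrow> y s = 0" by blast
    have a: "a \<in> {a..b}" using \<open>a < b\<close> by simp
    have "((\<lambda>_. 0) has_vector_derivative \<i> * k * w a) (at a within {a..b})"
      by (rule has_vector_derivative_transform[OF a _ y[OF a]]) (simp add: y0)
    then have "\<i> * k * w a = 0"
      using vector_derivative_unique_within_closed_interval[OF \<open>a < b\<close>, of a "\<lambda>_. 0" "\<i> * k * w a" 0] a by simp
    then show False using nz[OF a] y0[OF a] k by simp
  qed
  moreover have "boundary_condition k \<eta>1 (y a) (\<i> * k * w a)" "boundary_condition k \<eta>2 (y b) (\<i> * k * w b)"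
    using ra boundary_condition_iff_ratio[OF k] by auto
  ultimately show "k \<in> eigenvalues a b \<eta>1 \<eta>2 \<epsilon>"
    unfolding eigenvalues_def mem_Collect_eq using k y v
    by (intro conjI exI[of _ y] exI[of _ "\<lambda>s. \<i> * k * w s"] ballI) auto
qed

lemma eigenvalues_cong_ae:
  assumes "negligible N" "\<And>s. s \<in> {a..b} - N \<Longrightarrow> \<epsilon> s = \<epsilon>' s"
  shows "eigenvalues a b \<eta>1 \<eta>2 \<epsilon> = eigenvalues a b \<eta>1 \<eta>2 \<epsilon>'"
proof -
  have "caratheodory_solution (\<lambda>s _. - k\<^sup>2 * of_real (\<epsilon> s) * y s) a b v \<longleftrightarrow>
      caratheodory_solution (\<lambda>s _. - k\<^sup>2 * of_real (\<epsilon>' s) * y s) a b v" for k y v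
    by (rule caratheodory_solution_cong_ae[OF assms(1)]) (simp add: assms(2))
  then show ?thesis unfolding eigenvalues_def by simp
qed

lemma trajectory_cong_ae:
  assumes "negligible N" "\<And>s. s \<in> {a..b} - N \<Longrightarrow> \<epsilon> s = \<epsilon>' s" "trajectory \<kappa> \<epsilon> a b x"
  shows "trajectory \<kappa> \<epsilon>' a b x"
proof -
  have "caratheodory_solution (\<lambda>s z. \<i> * \<kappa> * (- z\<^sup>2 + of_real (\<epsilon> s))) c d f \<longleftrightarrow>
      caratheodory_solution (\<lambda>s z. \<i> * \<kappa> * (- z\<^sup>2 + of_real (\<epsilon>' s))) c d f"
    "caratheodory_solution (\<lambda>s z. \<i> * \<kappa> * (- 1 + of_real (\<epsilon> s) * z\<^sup>2)) c d f \<longleftrightarrow>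
      caratheodory_solution (\<lambda>s z. \<i> * \<kappa> * (- 1 + of_real (\<epsilon>' s) * z\<^sup>2)) c d f"
    if "{c..d} \<subseteq> {a..b}" for c d f
    by (rule caratheodory_solution_cong_ae[OF assms(1)]; use assms(2) that in auto)+
  then show ?thesis using assms(3) unfolding trajectory_def by simp
qed

lemma steers_cong_ae:
  assumes "negligible N" "\<And>s. s \<in> {a..a + t} - N \<Longrightarrow> \<epsilon> s = \<epsilon>' s"
  shows "steers \<kappa> \<epsilon> a t \<eta>1 \<eta>2 \<longleftrightarrow> steers \<kappa> \<epsilon>' a t \<eta>1 \<eta>2"
  unfolding steers_def using trajectory_cong_ae[OF assms(1)] assms(2) by metis

section \<open>Trajectories on the sphere and their linear lifts\<close>

lemma ratio_eq_None_iff: "ratio u v = None \<longleftrightarrow> u = 0"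
  by (simp add: ratio_def)

lemma ratio_eq_Some_0_iff: "u \<noteq> 0 \<or> v \<noteq> 0 \<Longrightarrow> ratio u v = Some 0 \<longleftrightarrow> v = 0"
  by (auto simp: ratio_def)

lemma ratio_eq_imp_proportional:
  assumes "u \<noteq> 0 \<or> v \<noteq> 0" "u' \<noteq> 0 \<or> v' \<noteq> 0" "ratio u v = ratio u' v'"
  obtains c where "c \<noteq> 0" "u = c * u'" "v = c * v'"
proof (cases "u = 0")
  case True
  then have "u' = 0" using assms(3) by (metis ratio_eq_None_iff)
  then show ?thesis using that[of "v / v'"] True assms by simp
next
  case False
  then have "u' \<noteq> 0" using assms(3) by (metis ratio_eq_None_iff)
  then show ?thesis using that[of "u / u'"] False assms(3) by (simp add: ratio_def field_simps)
qed

lemma ratio_scale: "c \<noteq> 0 \<Longrightarrow> ratio (c * u) (c * v) = ratio u v"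
  by (simp add: ratio_def)

text \<open>A neighbourhood of infinity in the sphere is met where w / y lies outside a compact set; near
zeros of y this is expressed through the continuous function y / w.\<close>

lemma continuous_map_ratio:
  assumes y: "continuous_on S y" and w: "continuous_on S w"
    and nz: "\<And>s. s \<in> S \<Longrightarrow> y s \<noteq> 0 \<or> w s \<noteq> 0"
  shows "continuous_map (top_of_set S) sphere_topology (\<lambda>s. ratio (y s) (w s))"
proof -
  have nonzero: "openin (top_of_set S) {s \<in> S. f s \<noteq> 0}" if "continuous_on S f" for f :: "'a \<Rightarrow> complex"
    using continuous_openin_preimage_gen[OF that open_Compl[OF closed_singleton[of 0]]] by (simp add: vimage_def Int_def)
  have quot: "openin (top_of_set S) {s \<in> S. g s \<noteq> 0 \<and> f s / g s \<in> U}"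
    if "continuous_on S f" "continuous_on S g" "open U" for f g :: "'a \<Rightarrow> complex" and U
  proof -
    let ?A = "{s \<in> S. g s \<noteq> 0}"
    have "continuous_on ?A (\<lambda>s. f s / g s)"
      by (intro continuous_intros continuous_on_subset[OF that(1)] continuous_on_subset[OF that(2)]) auto
    then have "openin (top_of_set ?A) (?A \<inter> (\<lambda>s. f s / g s) -` U)"
      using that(3) by (rule continuous_openin_preimage_gen)
    then have "openin (top_of_set S) (?A \<inter> (\<lambda>s. f s / g s) -` U)"
      using nonzero[OF that(2)] by (rule openin_trans)
    moreover have "?A \<inter> (\<lambda>s. f s / g s) -` U = {s \<in> S. g s \<noteq> 0 \<and> f s / g s \<in> U}" by auto
    ultimately show ?thesis by simp
  qed
  have "openin (top_of_set S) {s \<in> S. ratio (y s) (w s) \<in> V}" if V: "openin sphere_topology V" for V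
  proof -
    consider U where "open U" "V = Some ` U" | C where "compact C" "V = insert None (Some ` (- C))"
      using V by (auto simp: openin_Alexandroff_compactification Compl_eq_Diff_UNIV)
    then show ?thesis
    proof cases
      case 1
      have "{s \<in> S. ratio (y s) (w s) \<in> V} = {s \<in> S. y s \<noteq> 0 \<and> w s / y s \<in> U}"
        using 1 by (auto simp: ratio_def)
      then show ?thesis using quot[OF w y 1(1)] by simp
    next
      case 2
      obtain R where R: "0 < R" "\<And>c. c \<in> C \<Longrightarrow> norm c \<le> R"
        using compact_imp_bounded[OF 2(1)] by (auto simp: bounded_pos)
      have "{s \<in> S. ratio (y s) (w s) \<in> V} =
          {s \<in> S. y s \<noteq> 0 \<and> w s / y s \<in> - C} \<union> {s \<in> S. w s \<noteq> 0 \<and> y s / w s \<in> ball 0 (1 / R)}" (is "?L = ?M")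
      proof (intro equalityI subsetI)
        fix s assume "s \<in> ?L"
        then show "s \<in> ?M" using 2 nz[of s] R(1) by (auto simp: ratio_def split: if_splits)
      next
        fix s assume s: "s \<in> ?M"
        show "s \<in> ?L"
        proof (cases "y s = 0")
          case False
          have "w s / y s \<notin> C" if "w s \<noteq> 0" "norm (y s / w s) < 1 / R"
          proof
            assume "w s / y s \<in> C"
            then have "norm (w s / y s) \<le> R" by (rule R)
            then show False using that False R(1) by (simp add: norm_divide field_simps)
          qed
          then show ?thesis using s False 2 by (auto simp: ratio_def)
        qed (use s 2 in \<open>auto simp: ratio_def\<close>)
      qed
      moreover have "open (- C)" by (rule open_Compl[OF compact_imp_closed[OF 2(1)]])
      ultimately show ?thesis using quot[OF w y, of "- C"] quot[OF y w open_ball[of 0 "1/R"]] by (simp only: openin_Un)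
    qed
  qed
  then show ?thesis
    by (auto simp: continuous_map_def Pi_iff) (metis UNIV_I not_None_eq rangeI)
qed

lemma linear_system_subinterval:
  assumes "linear_system k \<epsilon> a b y w" "{c..d} \<subseteq> {a..b}"
  shows "linear_system k \<epsilon> c d y w"
  using assms primitive_on_subinterval unfolding linear_system_def by blast

text \<open>The quotient rule applied to w / y and to - y / w turns the linear system, with p = i k, into the
control system in the two charts.\<close>

lemma quotient_derivative_identities:
  fixes y w p e :: complex
  shows "y \<noteq> 0 \<Longrightarrow> p * e * y * inverse y + w * (- (p * w) / y\<^sup>2) = - p * (w * inverse y)\<^sup>2 + e * p"
    and "w \<noteq> 0 \<Longrightarrow> - (p * w * inverse w + y * (- (p * e * y) / w\<^sup>2)) = - p + e * (p * (y * inverse w)\<^sup>2)"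
  by (simp_all add: divide_inverse power2_eq_square algebra_simps)

lemma linear_system_imp_trajectory:
  assumes r: "regular_control n1 n2 \<epsilon>" and sys: "linear_system \<kappa> \<epsilon> a b y w"
    and nz: "\<And>s. s \<in> {a..b} \<Longrightarrow> y s \<noteq> 0 \<or> w s \<noteq> 0"
  shows "trajectory \<kappa> \<epsilon> a b (\<lambda>s. ratio (y s) (w s))"
  unfolding trajectory_def
proof (intro conjI allI impI)
  show "continuous_map (top_of_set {a..b}) sphere_topology (\<lambda>s. ratio (y s) (w s))"
    by (rule continuous_map_ratio[OF linear_system_continuous[OF sys] nz])
next
  fix c d assume cd: "{c..d} \<subseteq> {a..b} \<and> (\<forall>s\<in>{c..d}. ratio (y s) (w s) \<noteq> None)"
  then have y0: "\<And>s. s \<in> {c..d} \<Longrightarrow> y s \<noteq> 0" by (simp add: ratio_eq_None_iff)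
  have p: "primitive_on c d y (\<lambda>s. \<i> * \<kappa> * w s)" "primitive_on c d w (\<lambda>s. \<i> * \<kappa> * of_real (\<epsilon> s) * y s)"
    using linear_system_subinterval[OF sys] cd by (auto simp: linear_system_def)
  have "primitive_on c d (\<lambda>s. the (ratio (y s) (w s)))
      (\<lambda>s. - \<i> * \<kappa> * (w s * inverse (y s))\<^sup>2 + of_real (\<epsilon> s) * (\<i> * \<kappa>))"
    by (rule primitive_on_cong[OF primitive_on_mult[OF p(2) primitive_on_inverse[OF p(1) y0]]])
      (use y0 quotient_derivative_identities(1)[where p="\<i> * \<kappa>"] in \<open>auto simp: ratio_def divide_inverse\<close>)
  then show "caratheodory_solution (\<lambda>s z. \<i> * \<kappa> * (- z\<^sup>2 + of_real (\<epsilon> s))) c d (\<lambda>s. the (ratio (y s) (w s)))"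
    by (subst affine_control_primitive_iff[OF r, of c d "\<lambda>s. - \<i> * \<kappa> * (w s * inverse (y s))\<^sup>2" "\<lambda>_. \<i> * \<kappa>"])
      (use y0 in \<open>auto intro!: continuous_intros primitive_on_continuous[OF p(1)] primitive_on_continuous[OF p(2)]
        simp: ratio_def field_simps\<close>)
next
  fix c d assume cd: "{c..d} \<subseteq> {a..b} \<and> (\<forall>s\<in>{c..d}. ratio (y s) (w s) \<noteq> Some 0)"
  then have w0: "\<And>s. s \<in> {c..d} \<Longrightarrow> w s \<noteq> 0"
    using ratio_eq_Some_0_iff[OF nz] by blast
  have p: "primitive_on c d y (\<lambda>s. \<i> * \<kappa> * w s)" "primitive_on c d w (\<lambda>s. \<i> * \<kappa> * of_real (\<epsilon> s) * y s)"
    using linear_system_subinterval[OF sys] cd by (auto simp: linear_system_def)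
  have "primitive_on c d (\<lambda>s. chart_infinity (ratio (y s) (w s)))
      (\<lambda>s. - \<i> * \<kappa> + of_real (\<epsilon> s) * (\<i> * \<kappa> * (y s * inverse (w s))\<^sup>2))"
    by (rule primitive_on_cong[OF primitive_on_minus[OF primitive_on_mult[OF p(1) primitive_on_inverse[OF p(2) w0]]]])
      (use w0 quotient_derivative_identities(2)[where p="\<i> * \<kappa>"] in \<open>auto simp: chart_infinity_def ratio_def divide_inverse\<close>)
  then show "caratheodory_solution (\<lambda>s z. \<i> * \<kappa> * (- 1 + of_real (\<epsilon> s) * z\<^sup>2)) c d
      (\<lambda>s. chart_infinity (ratio (y s) (w s)))"
    by (subst affine_control_primitive_iff[OF r, of c d "\<lambda>_. - \<i> * \<kappa>" "\<lambda>s. \<i> * \<kappa> * (y s * inverse (w s))\<^sup>2"])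
      (use w0 in \<open>auto intro!: continuous_intros primitive_on_continuous[OF p(1)] primitive_on_continuous[OF p(2)]
        simp: chart_infinity_def ratio_def field_simps\<close>)
qed

text \<open>The trajectory x is the ratio of a nowhere vanishing solution of the linear system.\<close>

definition lifts :: "complex \<Rightarrow> (real \<Rightarrow> real) \<Rightarrow> (real \<Rightarrow> sphere) \<Rightarrow> real \<Rightarrow> real \<Rightarrow> bool" where
  "lifts \<kappa> \<epsilon> x a b \<longleftrightarrow> (\<exists>y w. linear_system \<kappa> \<epsilon> a b y w \<and>
    (\<forall>s\<in>{a..b}. (y s \<noteq> 0 \<or> w s \<noteq> 0) \<and> ratio (y s) (w s) = x s))"

lemma liftsI:
  assumes "primitive_on a b y (\<lambda>s. \<i> * \<kappa> * w s)" "primitive_on a b w (\<lambda>s. \<i> * \<kappa> * of_real (\<epsilon> s) * y s)"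
    "\<And>s. s \<in> {a..b} \<Longrightarrow> y s \<noteq> 0 \<or> w s \<noteq> 0" "\<And>s. s \<in> {a..b} \<Longrightarrow> ratio (y s) (w s) = x s"
  shows "lifts \<kappa> \<epsilon> x a b"
  unfolding lifts_def linear_system_def using assms by (intro exI[of _ y] exI[of _ w]) auto

lemma caratheodory_solution_continuous:
  assumes "caratheodory_solution F a b f"
  shows "continuous_on {a..b} f"
proof -
  have "continuous_on {a..b} (\<lambda>t. f a + integral {a..t} (\<lambda>s. F s (f s)))"
    using assms by (intro continuous_intros indefinite_integral_continuous_1)
      (auto simp: caratheodory_solution_def dest: set_lebesgue_integral_eq_integral(1))
  moreover have "continuous_on {a..b} (\<lambda>t. f a + integral {a..t} (\<lambda>s. F s (f s))) = continuous_on {a..b} f"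
    by (rule continuous_on_cong) (use assms in \<open>simp_all only: caratheodory_solution_def\<close>)
  ultimately show ?thesis by simp
qed

text \<open>The lift is y = exp (i \<kappa> \<integral> x) and w = x y: the first choice gives y' = i \<kappa> w, and then the control
system for x gives w' = i \<kappa> \<epsilon> y.\<close>

lemma lifts_finite_chart:
  assumes r: "regular_control n1 n2 \<epsilon>" and x: "\<And>s. s \<in> {c..d} \<Longrightarrow> x s \<noteq> None"
    and sol: "caratheodory_solution (\<lambda>s z. \<i> * \<kappa> * (- z\<^sup>2 + of_real (\<epsilon> s))) c d (\<lambda>s. the (x s))"
  shows "lifts \<kappa> \<epsilon> x c d"
proof -
  define X where "X s = the (x s)" for s
  have cX: "continuous_on {c..d} X"
    using caratheodory_solution_continuous[OF sol] by (simp add: X_def[abs_def])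
  have pX: "primitive_on c d X (\<lambda>s. - \<i> * \<kappa> * (X s)\<^sup>2 + of_real (\<epsilon> s) * (\<i> * \<kappa>))"
    using sol unfolding X_def[symmetric]
    by (subst (asm) affine_control_primitive_iff[OF r, of c d "\<lambda>s. - \<i> * \<kappa> * (X s)\<^sup>2" "\<lambda>_. \<i> * \<kappa>"])
      (auto intro!: continuous_intros cX simp: algebra_simps)
  define E where "E t = exp (\<i> * \<kappa> * integral {c..t} X)" for t
  have pE: "primitive_on c d E (\<lambda>s. E s * (\<i> * \<kappa> * X s))"
    unfolding E_def[abs_def]
    by (intro primitive_on_exp primitive_on_cmult primitive_on_indefinite_integral_continuous cX)
  have "primitive_on c d E (\<lambda>s. \<i> * \<kappa> * (X s * E s))"
    by (rule primitive_on_cong[OF pE]) auto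
  moreover have "primitive_on c d (\<lambda>s. X s * E s) (\<lambda>s. \<i> * \<kappa> * of_real (\<epsilon> s) * E s)"
    by (rule primitive_on_cong[OF primitive_on_mult[OF pX pE]]) (auto simp: power2_eq_square algebra_simps)
  moreover have "E s \<noteq> 0" for s by (simp add: E_def)
  moreover have "ratio (E s) (X s * E s) = x s" if "s \<in> {c..d}" for s
    using x[OF that] \<open>E s \<noteq> 0\<close> by (auto simp: ratio_def X_def)
  ultimately show ?thesis by (intro liftsI) auto
qed

text \<open>In the coordinate z = - 1 / x the roles of y and w are exchanged: w = exp (- i \<kappa> \<integral> \<epsilon> z) and
y = - z w.\<close>

lemma lifts_infinite_chart:
  assumes r: "regular_control n1 n2 \<epsilon>" and x: "\<And>s. s \<in> {c..d} \<Longrightarrow> x s \<noteq> Some 0"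
    and sol: "caratheodory_solution (\<lambda>s z. \<i> * \<kappa> * (- 1 + of_real (\<epsilon> s) * z\<^sup>2)) c d (\<lambda>s. chart_infinity (x s))"
  shows "lifts \<kappa> \<epsilon> x c d"
proof -
  define Z where "Z s = chart_infinity (x s)" for s
  have cZ: "continuous_on {c..d} Z"
    using caratheodory_solution_continuous[OF sol] by (simp add: Z_def[abs_def])
  have pZ: "primitive_on c d Z (\<lambda>s. - \<i> * \<kappa> + of_real (\<epsilon> s) * (\<i> * \<kappa> * (Z s)\<^sup>2))"
    using sol unfolding Z_def[symmetric]
    by (subst (asm) affine_control_primitive_iff[OF r, of c d "\<lambda>_. - \<i> * \<kappa>" "\<lambda>s. \<i> * \<kappa> * (Z s)\<^sup>2"])
      (auto intro!: continuous_intros cZ simp: algebra_simps)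
  obtain B where B: "\<And>s. s \<in> {c..d} \<Longrightarrow> norm (of_real (\<epsilon> s) * Z s) \<le> B"
    using control_mult_measurable_bounded(2)[OF r cZ] by blast
  define E where "E t = exp (- \<i> * \<kappa> * integral {c..t} (\<lambda>s. of_real (\<epsilon> s) * Z s))" for t
  have pE: "primitive_on c d E (\<lambda>s. E s * (- \<i> * \<kappa> * (of_real (\<epsilon> s) * Z s)))"
    unfolding E_def[abs_def]
    by (intro primitive_on_exp primitive_on_cmult
      primitive_on_indefinite_integral[OF control_mult_measurable_bounded(1)[OF r cZ] B])
  have "primitive_on c d (\<lambda>s. - Z s * E s) (\<lambda>s. \<i> * \<kappa> * E s)"
    by (rule primitive_on_cong[OF primitive_on_minus[OF primitive_on_mult[OF pZ pE]]])
      (auto simp: power2_eq_square algebra_simps)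
  moreover have "primitive_on c d E (\<lambda>s. \<i> * \<kappa> * of_real (\<epsilon> s) * (- Z s * E s))"
    by (rule primitive_on_cong[OF pE]) auto
  moreover have E0: "E s \<noteq> 0" for s by (simp add: E_def)
  moreover have "ratio (- Z s * E s) (E s) = x s" if "s \<in> {c..d}" for s
    using x[OF that] E0[of s] by (cases "x s") (auto simp: ratio_def Z_def chart_infinity_def)
  ultimately show ?thesis by (intro liftsI) auto
qed

text \<open>At the common instant b both lifts represent the same point x b, so they differ there by a
nonzero factor, and the second lift can be multiplied by it.\<close>

lemma lifts_trans:
  assumes l: "lifts \<kappa> \<epsilon> x a b" "lifts \<kappa> \<epsilon> x b c" and ab: "a \<le> b" "b \<le> c"
  shows "lifts \<kappa> \<epsilon> x a c"
proof -
  obtain y w where 1: "linear_system \<kappa> \<epsilon> a b y w"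
    "\<And>s. s \<in> {a..b} \<Longrightarrow> (y s \<noteq> 0 \<or> w s \<noteq> 0) \<and> ratio (y s) (w s) = x s"
    using l(1) unfolding lifts_def by blast
  obtain u v where 2: "linear_system \<kappa> \<epsilon> b c u v"
    "\<And>s. s \<in> {b..c} \<Longrightarrow> (u s \<noteq> 0 \<or> v s \<noteq> 0) \<and> ratio (u s) (v s) = x s"
    using l(2) unfolding lifts_def by blast
  obtain m where m: "m \<noteq> 0" "y b = m * u b" "w b = m * v b"
    using ratio_eq_imp_proportional[of "y b" "w b" "u b" "v b"] 1(2)[of b] 2(2)[of b] ab by auto
  define Y where "Y s = (if s \<le> b then y s else m * u s)" for s
  define W where "W s = (if s \<le> b then w s else m * v s)" for s
  have r: "Y s = m * u s" "W s = m * v s" if "s \<in> {b..c}" for s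
    using that m by (cases "s = b"; simp add: Y_def W_def)+
  have "primitive_on a b Y (\<lambda>s. \<i> * \<kappa> * W s)"
    by (rule primitive_on_cong[of a b y "\<lambda>s. \<i> * \<kappa> * w s"]) (use 1(1) in \<open>auto simp: linear_system_def Y_def W_def\<close>)
  moreover have "primitive_on a b W (\<lambda>s. \<i> * \<kappa> * of_real (\<epsilon> s) * Y s)"
    by (rule primitive_on_cong[of a b w "\<lambda>s. \<i> * \<kappa> * of_real (\<epsilon> s) * y s"])
      (use 1(1) in \<open>auto simp: linear_system_def Y_def W_def\<close>)
  moreover have "primitive_on b c Y (\<lambda>s. \<i> * \<kappa> * W s)"
    by (rule primitive_on_cong[OF primitive_on_cmult[of b c u "\<lambda>s. \<i> * \<kappa> * v s" m]])
      (use 2(1) r in \<open>auto simp: linear_system_def\<close>)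
  moreover have "primitive_on b c W (\<lambda>s. \<i> * \<kappa> * of_real (\<epsilon> s) * Y s)"
    by (rule primitive_on_cong[OF primitive_on_cmult[of b c v "\<lambda>s. \<i> * \<kappa> * of_real (\<epsilon> s) * u s" m]])
      (use 2(1) r in \<open>auto simp: linear_system_def\<close>)
  ultimately have "linear_system \<kappa> \<epsilon> a c Y W"
    unfolding linear_system_def using ab by (intro conjI primitive_on_glue[where a=a and b=b and c=c])
  moreover have "(Y s \<noteq> 0 \<or> W s \<noteq> 0) \<and> ratio (Y s) (W s) = x s" if "s \<in> {a..c}" for s
    using 1(2)[of s] 2(2)[of s] that m(1) by (simp add: Y_def W_def ratio_scale)
  ultimately show ?thesis unfolding lifts_def by blast
qed

text \<open>By continuity of x each instant has a neighbourhood in which x avoids either infinity or 0, so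
lifts exist locally. Bisection, in the form of \<open>Bolzano\<close>, passes to the whole interval.\<close>

lemma trajectory_lifts:
  assumes r: "regular_control n1 n2 \<epsilon>" and "a \<le> b" and t: "trajectory \<kappa> \<epsilon> a b x"
  shows "lifts \<kappa> \<epsilon> x a b"
proof -
  note t' = t[unfolded trajectory_def]
  have avoid: "\<exists>\<delta>>0. \<forall>r\<in>{a..b}. \<bar>r - s\<bar> < \<delta> \<longrightarrow> x r \<noteq> p"
    if "openin sphere_topology (- {p})" "s \<in> {a..b}" "x s \<noteq> p" for s p
  proof -
    have "openin (top_of_set {a..b}) {r \<in> {a..b}. x r \<in> - {p}}"
      using openin_continuous_map_preimage[OF t'[THEN conjunct1] that(1)] by simp
    moreover have "s \<in> {r \<in> {a..b}. x r \<in> - {p}}" using that by simp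
    ultimately obtain \<delta> where "\<delta> > 0" "ball s \<delta> \<inter> {a..b} \<subseteq> {r \<in> {a..b}. x r \<in> - {p}}"
      unfolding openin_contains_ball by blast
    moreover have "r \<in> ball s \<delta> \<inter> {a..b}" if "r \<in> {a..b}" "\<bar>r - s\<bar> < \<delta>" for r
      using that by (simp add: dist_real_def abs_minus_commute)
    ultimately show ?thesis by blast
  qed
  have None: "openin sphere_topology (- {None})"
  proof -
    have "- {None} = Some ` (UNIV :: complex set)" by (auto simp: image_def)
    then show ?thesis by (metis open_UNIV open_openin openin_Alexandroff_compactification_image_Some)
  qed
  have zero: "openin sphere_topology (- {Some 0})"
  proof -
    have "- {Some 0} = insert None (Some ` (UNIV - {0 :: complex}))"
      by (auto simp: image_def)
    moreover have "compactin euclidean {0 :: complex}" by simp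
    ultimately show ?thesis
      unfolding openin_Alexandroff_compactification by (metis closed_closedin closed_singleton topspace_euclidean)
  qed
  have "{a..b} \<subseteq> {a..b} \<longrightarrow> lifts \<kappa> \<epsilon> x a b"
  proof (rule Bolzano[where P = "\<lambda>c d. {c..d} \<subseteq> {a..b} \<longrightarrow> lifts \<kappa> \<epsilon> x c d", OF \<open>a \<le> b\<close>])
    fix c m d
    assume *: "{c..m} \<subseteq> {a..b} \<longrightarrow> lifts \<kappa> \<epsilon> x c m" "{m..d} \<subseteq> {a..b} \<longrightarrow> lifts \<kappa> \<epsilon> x m d" "c \<le> m" "m \<le> d"
    show "{c..d} \<subseteq> {a..b} \<longrightarrow> lifts \<kappa> \<epsilon> x c d"
    proof
      assume "{c..d} \<subseteq> {a..b}"
      moreover have "{c..m} \<subseteq> {c..d}" "{m..d} \<subseteq> {c..d}" using * by auto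
      ultimately show "lifts \<kappa> \<epsilon> x c d" using * lifts_trans by blast
    qed
  next
    fix s assume "a \<le> s" "s \<le> b"
    then have s: "s \<in> {a..b}" by simp
    show "\<exists>\<delta>>0. \<forall>c d. c \<le> s \<and> s \<le> d \<and> d - c < \<delta> \<longrightarrow> {c..d} \<subseteq> {a..b} \<longrightarrow> lifts \<kappa> \<epsilon> x c d"
    proof (cases "x s = None")
      case False
      obtain \<delta> where \<delta>: "\<delta> > 0" "\<And>r. r \<in> {a..b} \<Longrightarrow> \<bar>r - s\<bar> < \<delta> \<Longrightarrow> x r \<noteq> None"
        using avoid[OF None s False] by blast
      have "lifts \<kappa> \<epsilon> x c d" if "c \<le> s \<and> s \<le> d \<and> d - c < \<delta>" "{c..d} \<subseteq> {a..b}" for c d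
      proof (rule lifts_finite_chart[OF r])
        show *: "x q \<noteq> None" if "q \<in> {c..d}" for q
          by (rule \<delta>(2)) (use that \<open>c \<le> s \<and> s \<le> d \<and> d - c < \<delta>\<close> \<open>{c..d} \<subseteq> {a..b}\<close> in auto)
        show "caratheodory_solution (\<lambda>s z. \<i> * \<kappa> * (- z\<^sup>2 + of_real (\<epsilon> s))) c d (\<lambda>s. the (x s))"
          using t' that(2) * by blast
      qed
      then show ?thesis using \<delta>(1) by blast
    next
      case True
      then have "x s \<noteq> Some 0" by simp
      then obtain \<delta> where \<delta>: "\<delta> > 0" "\<And>r. r \<in> {a..b} \<Longrightarrow> \<bar>r - s\<bar> < \<delta> \<Longrightarrow> x r \<noteq> Some 0"
        using avoid[OF zero s] by blast
      have "lifts \<kappa> \<epsilon> x c d" if "c \<le> s \<and> s \<le> d \<and> d - c < \<delta>" "{c..d} \<subseteq> {a..b}" for c d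
      proof (rule lifts_infinite_chart[OF r])
        show *: "x q \<noteq> Some 0" if "q \<in> {c..d}" for q
          by (rule \<delta>(2)) (use that \<open>c \<le> s \<and> s \<le> d \<and> d - c < \<delta>\<close> \<open>{c..d} \<subseteq> {a..b}\<close> in auto)
        show "caratheodory_solution (\<lambda>s z. \<i> * \<kappa> * (- 1 + of_real (\<epsilon> s) * z\<^sup>2)) c d (\<lambda>s. chart_infinity (x s))"
          using t' that(2) * by blast
      qed
      then show ?thesis using \<delta>(1) by blast
    qed
  qed
  then show ?thesis by simp
qed

lemma steers_iff_linked:
  assumes r: "regular_control n1 n2 \<epsilon>" and "0 \<le> t"
  shows "steers \<kappa> \<epsilon> s t \<eta>1 \<eta>2 \<longleftrightarrow> linked \<kappa> \<epsilon> s (s + t) \<eta>1 \<eta>2"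
proof
  assume "steers \<kappa> \<epsilon> s t \<eta>1 \<eta>2"
  then obtain x where x: "trajectory \<kappa> \<epsilon> s (s + t) x" "x s = \<eta>1" "x (s + t) = \<eta>2"
    unfolding steers_def by blast
  have "lifts \<kappa> \<epsilon> x s (s + t)" using trajectory_lifts[OF r _ x(1)] assms by simp
  then show "linked \<kappa> \<epsilon> s (s + t) \<eta>1 \<eta>2"
    unfolding lifts_def linked_def using x(2,3) assms(2) by fastforce
next
  assume "linked \<kappa> \<epsilon> s (s + t) \<eta>1 \<eta>2"
  then show "steers \<kappa> \<epsilon> s t \<eta>1 \<eta>2"
    unfolding linked_def steers_def using linear_system_imp_trajectory[OF r] by blast
qed

section \<open>Functions with prescribed growth rates as integrals\<close>

text \<open>The Stieltjes measures of P and of the complementary function t - P t add up to Lebesgue measure.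
Hence both are absolutely continuous, and their Radon-Nikodym densities add up to 1; so the
density of the first one takes values in [0, 1].\<close>

lemma nonexpansive_mono_density:
  fixes P :: "real \<Rightarrow> real"
  assumes P: "\<And>s t. s \<le> t \<Longrightarrow> 0 \<le> P t - P s \<and> P t - P s \<le> t - s"
  obtains u where "u \<in> borel_measurable borel" "\<And>s. 0 \<le> u s \<and> u s \<le> 1"
    "\<And>s t. s \<le> t \<Longrightarrow> (u has_integral (P t - P s)) {s..t}"
proof -
  define Q where "Q t = t - P t" for t
  define \<mu> where "\<mu> = interval_measure P"
  define \<nu> where "\<nu> = interval_measure Q"
  have cont: "continuous_on UNIV P"
  proof -
    have "\<bar>P t - P s\<bar> \<le> \<bar>t - s\<bar>" for s t using P[of s t] P[of t s] by (cases "s \<le> t") auto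
    then have "1-lipschitz_on UNIV P" by (auto intro!: lipschitz_onI simp: dist_real_def abs_minus_commute)
    then show ?thesis by (rule lipschitz_on_continuous_on)
  qed
  then have contQ: "continuous_on UNIV Q" unfolding Q_def by (intro continuous_intros)
  have mono: "\<And>s t. s \<le> t \<Longrightarrow> P s \<le> P t" "\<And>s t. s \<le> t \<Longrightarrow> Q s \<le> Q t"
    using P unfolding Q_def by fastforce+
  have rc: "continuous (at_right r) P" "continuous (at_right r) Q" for r
    using cont contQ by (auto simp: continuous_on_eq_continuous_within intro: continuous_within_subset)
  have \<mu>: "emeasure \<mu> {s<..t} = ennreal (P t - P s)" if "s \<le> t" for s t
    unfolding \<mu>_def using emeasure_interval_measure_Ioc[OF that mono(1) rc(1)] by simp
  have \<nu>: "emeasure \<nu> {s<..t} = ennreal (Q t - Q s)" if "s \<le> t" for s t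
    unfolding \<nu>_def using emeasure_interval_measure_Ioc[OF that mono(2) rc(2)] by simp
  have sets: "sets \<mu> = sets borel" "sets \<nu> = sets borel" by (simp_all add: \<mu>_def \<nu>_def)
  \<comment> \<open>Both sides are measures, and they agree on half-open intervals, as P + Q is the identity.\<close>
  have sum_eq: "emeasure \<mu> A + emeasure \<nu> A = emeasure lborel A" if A: "A \<in> sets borel" for A
  proof -
    define M where "M = measure_of UNIV (sets borel) (\<lambda>A. emeasure \<mu> A + emeasure \<nu> A)"
    have sM: "sets M = sets borel"
      using sets.sets_measure_of_eq[of borel] by (simp add: M_def)
    have eM: "emeasure M A = emeasure \<mu> A + emeasure \<nu> A" if "A \<in> sets borel" for A
    proof (rule emeasure_measure_of[OF M_def])
      show "positive (sets M) (\<lambda>A. emeasure \<mu> A + emeasure \<nu> A)" by (simp add: positive_def)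
      show "countably_additive (sets M) (\<lambda>A. emeasure \<mu> A + emeasure \<nu> A)"
      proof (rule countably_additiveI)
        fix B :: "nat \<Rightarrow> real set"
        assume B: "range B \<subseteq> sets M" "disjoint_family B"
        have "(\<Sum>i. emeasure \<mu> (B i) + emeasure \<nu> (B i)) = (\<Sum>i. emeasure \<mu> (B i)) + (\<Sum>i. emeasure \<nu> (B i))"
          by (intro suminf_add[symmetric]) auto
        also have "\<dots> = emeasure \<mu> (\<Union>i. B i) + emeasure \<nu> (\<Union>i. B i)"
          using B sets by (simp add: suminf_emeasure sM)
        finally show "(\<Sum>i. emeasure \<mu> (B i) + emeasure \<nu> (B i)) = emeasure \<mu> (\<Union>i. B i) + emeasure \<nu> (\<Union>i. B i)" .
      qed
    qed (use that in \<open>auto simp: M_def\<close>)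
    have "interval_measure (\<lambda>x. x) = M"
    proof (rule measure_eqI_generator_eq[where E="range (\<lambda>(s, t). {s<..t::real})" and \<Omega>=UNIV and A="\<lambda>i::nat. {- real i<..real i}"])
      show "Int_stable (range (\<lambda>(s, t). {s<..t::real}))"
        by (auto simp: Int_stable_def Int_greaterThanAtMost)
      show "emeasure (interval_measure (\<lambda>x. x)) X = emeasure M X" if X': "X \<in> range (\<lambda>(s, t). {s<..t::real})" for X
      proof -
        obtain s t where X: "X = {s<..t}" using X' by auto
        show ?thesis
        proof (cases "s \<le> t")
          case True
          then have "emeasure M X = ennreal (t - s)"
            using P[OF True] by (simp add: eM X \<mu> \<nu> Q_def flip: ennreal_plus)
          then show ?thesis using True unfolding X lborel_eq_real[symmetric] by simp
        qed (simp add: X)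
      qed
      show "sets (interval_measure (\<lambda>x. x)) = sigma_sets UNIV (range (\<lambda>(s, t). {s<..t::real}))"
        by (simp add: borel_sigma_sets_Ioc)
      show "sets M = sigma_sets UNIV (range (\<lambda>(s, t). {s<..t::real}))"
        by (simp add: sM) (simp add: borel_sigma_sets_Ioc)
      show "(\<Union>i. {- real i<..real i}) = UNIV"
      proof (intro equalityI subsetI UNIV_I)
        fix x :: real
        obtain i where "\<bar>x\<bar> < real i" using reals_Archimedean2 by blast
        then show "x \<in> (\<Union>i. {- real i<..real i})" by (intro UN_I[of i]) auto
      qed
      show "emeasure (interval_measure (\<lambda>x. x)) {- real i<..real i} \<noteq> \<infinity>" for i
        unfolding lborel_eq_real[symmetric] by simp
    qed auto
    then show ?thesis using eM[OF A] by (simp add: lborel_eq_real)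
  qed
  have ac: "absolutely_continuous lborel \<mu>" "absolutely_continuous lborel \<nu>"
    unfolding absolutely_continuous_def
    using sum_eq sets by (auto simp: null_sets_def) (metis add_eq_0_iff_both_eq_0)+
  obtain f where f: "f \<in> borel_measurable lborel" "density lborel f = \<mu>"
    using sigma_finite_measure.Radon_Nikodym[OF sigma_finite_lborel ac(1)] sets by auto
  obtain g where g: "g \<in> borel_measurable lborel" "density lborel g = \<nu>"
    using sigma_finite_measure.Radon_Nikodym[OF sigma_finite_lborel ac(2)] sets by auto
  have "density lborel (\<lambda>x. f x + g x) = density lborel (\<lambda>_. 1)"
  proof (rule measure_eqI)
    fix A assume "A \<in> sets (density lborel (\<lambda>x. f x + g x))"
    then have A: "A \<in> sets borel" by simp
    have "emeasure (density lborel (\<lambda>x. f x + g x)) A = emeasure (density lborel f) A + emeasure (density lborel g) A"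
      using f(1) g(1) A by (simp add: emeasure_density nn_integral_add distrib_right)
    also have "\<dots> = emeasure lborel A" unfolding f(2) g(2) by (rule sum_eq[OF A])
    finally show "emeasure (density lborel (\<lambda>x. f x + g x)) A = emeasure (density lborel (\<lambda>_. 1)) A"
      by (simp add: density_1)
  qed simp
  then have "AE x in lborel. f x + g x = 1"
    using f g by (intro sigma_finite_measure.density_unique[OF sigma_finite_lborel]) auto
  then have f1: "AE x in lborel. f x \<le> 1"
    by eventually_elim (metis add_increasing2 order_refl zero_le)
  define u where "u s = enn2real (min 1 (f s))" for s
  have u01: "0 \<le> u s \<and> u s \<le> 1" for s
    unfolding u_def by (auto simp: enn2real_leI)
  have um: "u \<in> borel_measurable borel"
    using f(1) unfolding u_def by simp
  have ae: "AE x in lborel. ennreal (u x) = f x"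
    using f1
  proof eventually_elim
    case (elim x)
    then have "f x < top" using le_less_trans ennreal_one_less_top by blast
    with elim show ?case by (simp add: u_def min_absorb2)
  qed
  have "(u has_integral (P t - P s)) {s..t}" if "s \<le> t" for s t
  proof -
    have "((\<lambda>x. u x * indicator {s<..t} x) has_integral (P t - P s)) UNIV"
    proof (rule nn_integral_has_integral)
      have "(\<integral>\<^sup>+x. ennreal (u x * indicator {s<..t} x) \<partial>lborel) = (\<integral>\<^sup>+x. f x * indicator {s<..t} x \<partial>lborel)"
        using ae by (intro nn_integral_cong_AE) (auto elim!: eventually_mono simp: indicator_def)
      also have "\<dots> = emeasure \<mu> {s<..t}"
        unfolding f(2)[symmetric] by (rule emeasure_density[OF f(1), symmetric]) simp
      finally show "(\<integral>\<^sup>+x. ennreal (u x * indicator {s<..t} x) \<partial>lborel) = ennreal (P t - P s)"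
        using \<mu>[OF that] by simp
    qed (use um u01 P[OF that] in auto)
    moreover have "(\<lambda>x. u x * indicator {s<..t} x) = (\<lambda>x. if x \<in> {s<..t} then u x else 0)" by auto
    ultimately have "(u has_integral (P t - P s)) {s<..t}"
      using has_integral_restrict_UNIV[of "{s<..t}" u "P t - P s"] by simp
    moreover have "negligible {x \<in> {s<..t} - {s..t}. u x \<noteq> 0}" "negligible {x \<in> {s..t} - {s<..t}. u x \<noteq> 0}"
      by (rule negligible_subset[of "{s}"]; auto)+
    ultimately show ?thesis using has_integral_spike_set_eq by blast
  qed
  then show ?thesis using that um u01 by blast
qed

text \<open>The growth rates of \<open>(G t - n1\<^sup>2 t) / (n2\<^sup>2 - n1\<^sup>2)\<close> lie in [0, 1]. This function is extended to
the real line by constants, and its density is carried back to the interval from n1^2 to n2^2.\<close>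

lemma control_of_primitive:
  fixes G :: "real \<Rightarrow> real"
  assumes n: "n1\<^sup>2 < n2\<^sup>2" and "a \<le> b"
    and G: "\<And>s t. a \<le> s \<Longrightarrow> s \<le> t \<Longrightarrow> t \<le> b \<Longrightarrow> n1\<^sup>2 * (t - s) \<le> G t - G s \<and> G t - G s \<le> n2\<^sup>2 * (t - s)"
  obtains \<epsilon> where "regular_control n1 n2 \<epsilon>"
    "\<And>t. t \<in> {a..b} \<Longrightarrow> (\<epsilon> has_integral (G t - G a)) {a..t}"
proof -
  define C where "C = n2\<^sup>2 - n1\<^sup>2"
  have C: "0 < C" using n by (simp add: C_def)
  define cl where "cl t = max a (min b t)" for t
  define P where "P t = (G (cl t) - n1\<^sup>2 * cl t) / C" for t
  have P: "0 \<le> P t - P s \<and> P t - P s \<le> t - s" if "s \<le> t" for s t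
  proof -
    have cl: "a \<le> cl s" "cl s \<le> cl t" "cl t \<le> b" "cl t - cl s \<le> t - s"
      using that \<open>a \<le> b\<close> by (auto simp: cl_def)
    have e: "P t - P s = (G (cl t) - G (cl s) - n1\<^sup>2 * (cl t - cl s)) / C"
      using C by (simp add: P_def field_simps)
    have "0 \<le> P t - P s" unfolding e using G[OF cl(1-3)] C by simp
    moreover have "P t - P s \<le> cl t - cl s"
      unfolding e using G[OF cl(1-3)] C by (simp add: divide_le_eq) (simp add: C_def algebra_simps)
    ultimately show ?thesis using cl(4) by simp
  qed
  obtain u where u: "u \<in> borel_measurable borel" "\<And>s. 0 \<le> u s \<and> u s \<le> 1"
    "\<And>s t. s \<le> t \<Longrightarrow> (u has_integral (P t - P s)) {s..t}"
    using nonexpansive_mono_density[OF P] by blast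
  define \<epsilon> where "\<epsilon> s = n1\<^sup>2 + C * u s" for s
  show ?thesis
  proof (rule that[of \<epsilon>])
    have "\<epsilon> s \<le> n2\<^sup>2" for s
    proof -
      have "C * u s \<le> C" using u(2)[of s] C by simp
      then show ?thesis unfolding \<epsilon>_def using C_def by linarith
    qed
    moreover have "n1\<^sup>2 \<le> \<epsilon> s" for s using u(2)[of s] C by (simp add: \<epsilon>_def)
    moreover have "\<epsilon> \<in> borel_measurable borel" unfolding \<epsilon>_def using u(1) by simp
    ultimately show "regular_control n1 n2 \<epsilon>" by (simp add: regular_control_def)
    fix t assume t: "t \<in> {a..b}"
    have "(\<epsilon> has_integral (n1\<^sup>2 * (t - a) + C * (P t - P a))) {a..t}"
      unfolding \<epsilon>_def using t has_integral_const_real[of "n1\<^sup>2" a t]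
      by (intro has_integral_add has_integral_mult_right u(3)) (auto simp: mult.commute)
    moreover have "n1\<^sup>2 * (t - a) + C * (P t - P a) = G t - G a"
    proof -
      have "cl t = t" "cl a = a" using t by (auto simp: cl_def)
      then have "C * (P t - P a) = (G t - n1\<^sup>2 * t) - (G a - n1\<^sup>2 * a)"
        using C unfolding P_def diff_divide_distrib[symmetric] by simp
      then show ?thesis by (simp add: algebra_simps)
    qed
    ultimately show "(\<epsilon> has_integral (G t - G a)) {a..t}" by simp
  qed
qed

section \<open>Limits of solutions and controls\<close>

lemma ratio_eq_iff:
  assumes "u \<noteq> 0 \<or> v \<noteq> 0"
  shows "ratio u v = \<eta> \<longleftrightarrow> (case \<eta> of None \<Rightarrow> u = 0 | Some z \<Rightarrow> v = z * u)"
  using assms by (auto simp: ratio_def field_simps split: option.splits)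

text \<open>For finite \<eta> as well as for infinite \<eta> the points with ratio \<eta> form a line of homogeneous
coordinates without the origin, and a line is closed.\<close>

lemma ratio_limit:
  assumes "u \<longlonglongrightarrow> u'" "v \<longlonglongrightarrow> v'" "u' \<noteq> 0 \<or> v' \<noteq> 0"
    and "\<And>n. u n \<noteq> 0 \<or> v n \<noteq> 0" "\<And>n. ratio (u n) (v n) = \<eta>"
  shows "ratio u' v' = \<eta>"
proof (cases \<eta>)
  case None
  then have "u n = 0" for n using assms(5)[of n] by (simp add: ratio_eq_None_iff)
  then have "u' = 0" using assms(1) LIMSEQ_unique[of u] by (metis LIMSEQ_const_iff ext)
  then show ?thesis using None by (simp add: ratio_eq_None_iff)
next
  case (Some z)
  then have "v n = z * u n" for n using assms(4,5)[of n] by (simp add: ratio_eq_iff)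
  then have "v = (\<lambda>n. z * u n)" by auto
  then have "v' = z * u'" using assms(2) tendsto_mult[OF tendsto_const assms(1), of z] LIMSEQ_unique by blast
  then show ?thesis using Some assms(3) by (simp add: ratio_eq_iff)
qed

lemma linked_normalized:
  assumes "linked k \<epsilon> a b \<eta>1 \<eta>2" "a \<le> b"
  obtains y w where "linear_system k \<epsilon> a b y w" "\<And>s. s \<in> {a..b} \<Longrightarrow> y s \<noteq> 0 \<or> w s \<noteq> 0"
    "ratio (y a) (w a) = \<eta>1" "ratio (y b) (w b) = \<eta>2" "norm (y a) + norm (w a) = 1"
proof -
  obtain y w where yw: "linear_system k \<epsilon> a b y w" "\<And>s. s \<in> {a..b} \<Longrightarrow> y s \<noteq> 0 \<or> w s \<noteq> 0"
    "ratio (y a) (w a) = \<eta>1" "ratio (y b) (w b) = \<eta>2"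
    using assms(1) unfolding linked_def by blast
  define m where "m = norm (y a) + norm (w a)"
  have m: "m > 0" using yw(2)[of a] assms(2) by (auto simp: m_def add_pos_nonneg add_nonneg_pos)
  define c where "c = complex_of_real (1 / m)"
  have c: "c \<noteq> 0" "norm c = 1 / m" using m by (simp_all add: c_def norm_divide)
  show ?thesis
  proof (rule that[of "\<lambda>s. c * y s" "\<lambda>s. c * w s"])
    have "primitive_on a b (\<lambda>s. c * y s) (\<lambda>s. \<i> * k * (c * w s))"
      by (rule primitive_on_cong[OF primitive_on_cmult[of a b y "\<lambda>s. \<i> * k * w s" c]])
        (use yw(1) in \<open>auto simp: linear_system_def\<close>)
    moreover have "primitive_on a b (\<lambda>s. c * w s) (\<lambda>s. \<i> * k * of_real (\<epsilon> s) * (c * y s))"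
      by (rule primitive_on_cong[OF primitive_on_cmult[of a b w "\<lambda>s. \<i> * k * of_real (\<epsilon> s) * y s" c]])
        (use yw(1) in \<open>auto simp: linear_system_def\<close>)
    ultimately show "linear_system k \<epsilon> a b (\<lambda>s. c * y s) (\<lambda>s. c * w s)" by (simp add: linear_system_def)
    have "norm (c * y a) + norm (c * w a) = (norm (y a) + norm (w a)) / m"
      by (simp add: norm_mult c(2) add_divide_distrib)
    then show "norm (c * y a) + norm (c * w a) = 1" using m by (simp flip: m_def)
  qed (use yw c in \<open>auto simp: ratio_scale\<close>)
qed

lemma regular_control_integrable:
  assumes "regular_control n1 n2 \<epsilon>"
  shows "\<epsilon> integrable_on {s..t}"
proof -
  have "\<epsilon> absolutely_integrable_on {s..t}"
    by (rule measurable_bounded_by_integrable_imp_absolutely_integrable[where g="\<lambda>_. n2\<^sup>2"])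
      (use regular_control_feasible[OF assms, of "{s..t}"] regular_control_norm_le[OF assms] in \<open>auto simp: feasible_def\<close>)
  then show ?thesis using set_lebesgue_integral_eq_integral(1) by blast
qed

lemma regular_control_integral_bounds:
  assumes r: "regular_control n1 n2 \<epsilon>" and "s \<le> t"
  shows "n1\<^sup>2 * (t - s) \<le> integral {s..t} \<epsilon>" "integral {s..t} \<epsilon> \<le> n2\<^sup>2 * (t - s)"
proof -
  note i = regular_control_integrable[OF r, of s t]
  have "integral {s..t} (\<lambda>_. n1\<^sup>2) \<le> integral {s..t} \<epsilon>" "integral {s..t} \<epsilon> \<le> integral {s..t} (\<lambda>_. n2\<^sup>2)"
    by (rule integral_le; use i r in \<open>auto simp: regular_control_def\<close>)+
  then show "n1\<^sup>2 * (t - s) \<le> integral {s..t} \<epsilon>" "integral {s..t} \<epsilon> \<le> n2\<^sup>2 * (t - s)"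
    using \<open>s \<le> t\<close> by (simp_all add: mult.commute)
qed

lemma control_primitive:
  assumes r: "regular_control n1 n2 \<epsilon>" and G: "\<And>t. t \<in> {a..b} \<Longrightarrow> (\<epsilon> has_integral G t) {a..t}"
  shows "primitive_on a b (\<lambda>t. of_real (G t)) (\<lambda>s. of_real (\<epsilon> s))"
proof (rule primitive_onI)
  show "(\<lambda>s. complex_of_real (\<epsilon> s)) \<in> borel_measurable (lebesgue_on {a..b})"
    by (rule regular_control_measurable[OF r])
  show "norm (complex_of_real (\<epsilon> s)) \<le> n2\<^sup>2" for s by (rule regular_control_norm_le[OF r])
  fix t assume t: "t \<in> {a..b}"
  have "((\<lambda>s. complex_of_real (\<epsilon> s)) has_integral of_real (G t)) {a..t}"
    using G[OF t] by (rule has_integral_of_real)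
  moreover have "G a = 0" using G[of a] t has_integral_unique[of \<epsilon> "G a" "{a..a}" 0] by (simp add: has_integral_refl)
  ultimately show "complex_of_real (G t) = of_real (G a) + integral {a..t} (\<lambda>s. of_real (\<epsilon> s))"
    by (simp add: integral_unique)
qed

text \<open>On the right-hand side the control occurs only through its primitive G, so the formula gives
access to limits of controls whose primitives converge uniformly.\<close>

lemma control_integral_by_parts:
  assumes r: "regular_control n1 n2 \<epsilon>" and G: "\<And>t. t \<in> {a..b} \<Longrightarrow> (\<epsilon> has_integral G t) {a..t}"
    and y: "primitive_on a b y Y" "continuous_on {a..b} Y" and t: "t \<in> {a..b}"
  shows "integral {a..t} (\<lambda>s. of_real (\<epsilon> s) * y s) = of_real (G t) * y t - integral {a..t} (\<lambda>s. of_real (G s) * Y s)"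
proof -
  note pG = control_primitive[OF r G]
  have ab: "{a..t} \<subseteq> {a..b}" using t by simp
  have iGY: "(\<lambda>s. of_real (G s) * Y s) integrable_on {a..t}"
    by (rule integrable_continuous_interval)
      (intro continuous_intros continuous_on_subset[OF primitive_on_continuous[OF pG] ab] continuous_on_subset[OF y(2) ab])
  obtain B where B: "\<forall>s\<in>{a..b}. norm (of_real (\<epsilon> s) * y s) \<le> B"
    using control_mult_measurable_bounded(2)[OF r primitive_on_continuous[OF y(1)]] by blast
  have i\<epsilon>: "(\<lambda>s. of_real (\<epsilon> s) * y s) integrable_on {a..t}"
    using bounded_measurable_imp_absolutely_integrable[OF control_mult_measurable_bounded(1)[OF r primitive_on_continuous[OF y(1)]] B ab]
      set_lebesgue_integral_eq_integral(1) by blast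
  have "G a = 0" using G[of a] t has_integral_unique[of \<epsilon> "G a" "{a..a}" 0] by (simp add: has_integral_refl)
  moreover have "of_real (G t) * y t = of_real (G a) * y a + integral {a..t} (\<lambda>s. of_real (\<epsilon> s) * y s + of_real (G s) * Y s)"
    by (rule primitive_onD[OF primitive_on_mult[OF pG y(1)] t])
  moreover have "integral {a..t} (\<lambda>s. of_real (\<epsilon> s) * y s + of_real (G s) * Y s)
      = integral {a..t} (\<lambda>s. of_real (\<epsilon> s) * y s) + integral {a..t} (\<lambda>s. of_real (G s) * Y s)"
    by (rule integral_add[OF i\<epsilon> iGY])
  ultimately show ?thesis by (simp add: algebra_simps)
qed

text \<open>Weak sequential compactness of the controls, transported to the boundary value problem: a
subsequence of the solutions and of the primitives of the controls converges uniformly, and the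
limits solve the boundary value problem of a limit control.\<close>

lemma linked_compact:
  assumes n: "n1\<^sup>2 < n2\<^sup>2" and "a \<le> b" and k: "k \<longlonglongrightarrow> k'"
    and l: "\<And>n. regular_control n1 n2 (\<epsilon> n)" "\<And>n. linked (k n) (\<epsilon> n) a b \<eta>1 \<eta>2"
  obtains \<epsilon>' where "regular_control n1 n2 \<epsilon>'" "linked k' \<epsilon>' a b \<eta>1 \<eta>2"
proof -
  have "\<forall>n. \<exists>y w. linear_system (k n) (\<epsilon> n) a b y w \<and> (\<forall>s\<in>{a..b}. y s \<noteq> 0 \<or> w s \<noteq> 0) \<and>
      ratio (y a) (w a) = \<eta>1 \<and> ratio (y b) (w b) = \<eta>2 \<and> norm (y a) + norm (w a) = 1"
    using linked_normalized[OF l(2) \<open>a \<le> b\<close>] by metis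
  then obtain y w where yw: "\<And>n. linear_system (k n) (\<epsilon> n) a b (y n) (w n)"
    "\<And>n s. s \<in> {a..b} \<Longrightarrow> y n s \<noteq> 0 \<or> w n s \<noteq> 0"
    "\<And>n. ratio (y n a) (w n a) = \<eta>1" "\<And>n. ratio (y n b) (w n b) = \<eta>2"
    "\<And>n. norm (y n a) + norm (w n a) = 1"
    by metis
  have py: "primitive_on a b (y n) (\<lambda>s. \<i> * k n * w n s)"
    and pw: "primitive_on a b (w n) (\<lambda>s. \<i> * k n * of_real (\<epsilon> n s) * y n s)" for n
    using yw(1)[of n] by (auto simp: linear_system_def)
  note cont = linear_system_continuous[OF yw(1)]
  obtain M where M: "0 < M" "\<And>n. norm (k n) \<le> M"
    using Bseq_def[of k] k convergent_imp_Bseq convergentI by (metis BseqE)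
  \<comment> \<open>A bound on all normalised solutions, uniform in n.\<close>
  define R where "R = exp (M * (1 + n2\<^sup>2) * (b - a))"
  have R: "0 < R" by (simp add: R_def)
  have bound: "norm (y n s) + norm (w n s) \<le> R" if "s \<in> {a..b}" for n s
  proof -
    have "norm (y n s) + norm (w n s) \<le> 1 * exp (norm (k n) * (1 + n2\<^sup>2) * \<bar>s - a\<bar>)"
      using linear_system_growth[OF yw(1)[of n] l(1)[of n], of a s] that yw(5)[of n] by simp
    also have "\<dots> \<le> R"
      unfolding R_def using that M by (auto intro!: mult_mono)
    finally show ?thesis .
  qed
  then have by': "norm (y n s) \<le> R" and bw: "norm (w n s) \<le> R" if "s \<in> {a..b}" for n s
    using that norm_ge_zero by (smt (verit))+
  define G where "G n t = integral {a..t} (\<epsilon> n)" for n t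
  have G: "n1\<^sup>2 * (t - s) \<le> G n t - G n s \<and> G n t - G n s \<le> n2\<^sup>2 * (t - s)"
    if "a \<le> s" "s \<le> t" for n s t
  proof -
    have "G n s + integral {s..t} (\<epsilon> n) = G n t"
      unfolding G_def by (rule Henstock_Kurzweil_Integration.integral_combine)
        (use that regular_control_integrable[OF l(1)] in auto)
    then show ?thesis using regular_control_integral_bounds[OF l(1)[of n], of s t] that(2) by simp
  qed
  have Ga: "G n a = 0" for n by (simp add: G_def)
  define L where "L = M * R + M * n2\<^sup>2 * R + n2\<^sup>2"
  have L: "0 \<le> L" using M R by (simp add: L_def)
  \<comment> \<open>Treating the three functions as one provides a common subsequence.\<close>
  define F where "F n s = (y n s, w n s, G n s)" for n s
  have lip1: "norm (F n t - F n s) \<le> L * (t - s)" if st: "a \<le> s" "s \<le> t" "t \<le> b" for n s t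
  proof -
    have "norm (y n t - y n s) \<le> M * R * (t - s)"
      unfolding primitive_on_diff[OF py st]
    proof (rule norm_integral_le_length[OF st(2) primitive_on_integrable[OF py]])
      fix r assume "r \<in> {s..t}"
      then have "norm (w n r) \<le> R" by (intro bw) (use st in auto)
      then show "norm (\<i> * k n * w n r) \<le> M * R"
        unfolding norm_mult using M by (auto intro!: mult_mono)
    qed (use st M R in auto)
    moreover have "norm (w n t - w n s) \<le> M * n2\<^sup>2 * R * (t - s)"
      unfolding primitive_on_diff[OF pw st]
    proof (rule norm_integral_le_length[OF st(2) primitive_on_integrable[OF pw]])
      fix r assume "r \<in> {s..t}"
      then have "norm (y n r) \<le> R" by (intro by') (use st in auto)
      then have "norm (\<i>::complex) * norm (k n) * norm (complex_of_real (\<epsilon> n r)) * norm (y n r) \<le> 1 * M * n2\<^sup>2 * R"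
        using M regular_control_norm_le[OF l(1), of n r] by (intro mult_mono) auto
      then show "norm (\<i> * k n * of_real (\<epsilon> n r) * y n r) \<le> M * n2\<^sup>2 * R"
        unfolding norm_mult by simp
    qed (use st M R in auto)
    moreover have "\<bar>G n t - G n s\<bar> \<le> n2\<^sup>2 * (t - s)"
    proof -
      have "0 \<le> n1\<^sup>2 * (t - s)" using st(2) by simp
      then show ?thesis using G[OF st(1,2), of n] by linarith
    qed
    moreover have "norm (F n t - F n s) \<le> norm (y n t - y n s) + (norm (w n t - w n s) + \<bar>G n t - G n s\<bar>)"
      unfolding F_def using norm_Pair_le[of "w n t - w n s" "G n t - G n s"]
        norm_Pair_le[of "y n t - y n s" "(w n t - w n s, G n t - G n s)"] by simp
    ultimately show ?thesis unfolding L_def by (simp add: algebra_simps)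
  qed
  have lip: "norm (F n t - F n s) \<le> L * \<bar>t - s\<bar>" if "s \<in> {a..b}" "t \<in> {a..b}" for n s t
    using lip1[of s t n] lip1[of t s n] that by (cases "s \<le> t") (auto simp: norm_minus_commute)
  obtain g r where g: "continuous_on {a..b} g" "strict_mono (r :: nat \<Rightarrow> nat)"
    "\<And>e. 0 < e \<Longrightarrow> \<exists>N. \<forall>n x. n \<ge> N \<and> x \<in> {a..b} \<longrightarrow> norm (F (r n) x - g x) < e"
  proof (rule Arzela_Ascoli[of "{a..b}" F "2 + L * (b - a)"])
    fix n s assume s: "s \<in> {a..b}"
    have "norm (F n a) \<le> norm (y n a) + (norm (w n a) + \<bar>G n a\<bar>)"
      unfolding F_def using norm_Pair_le[of "w n a" "G n a"] norm_Pair_le[of "y n a" "(w n a, G n a)"] by simp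
    then have "norm (F n a) \<le> 1" using yw(5)[of n] Ga by simp
    moreover have "norm (F n s - F n a) \<le> L * (b - a)"
      using lip[of a s n] s L mult_left_mono[of "s - a" "b - a" L] by auto
    ultimately show "norm (F n s) \<le> 2 + L * (b - a)"
      using norm_triangle_sub[of "F n s" "F n a"] by simp
  next
    fix s e :: real assume s: "s \<in> {a..b}" and e: "0 < e"
    have "norm (F n s - F n t) < e" if "t \<in> {a..b}" "norm (s - t) < e / (L + 1)" for n t
    proof -
      have "norm (F n s - F n t) \<le> L * \<bar>s - t\<bar>" using lip[OF that(1) s] .
      also have "\<dots> \<le> (L + 1) * \<bar>s - t\<bar>" by (simp add: mult_right_mono)
      also have "\<dots> < e" using that(2) L by (simp add: field_simps)
      finally show ?thesis .
    qed
    then show "\<exists>d. 0 < d \<and> (\<forall>n t. t \<in> {a..b} \<and> norm (s - t) < d \<longrightarrow> norm (F n s - F n t) < e)"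
      using e L by (intro exI[of _ "e / (L + 1)"]) auto
  qed (rule compact_Icc, rule that, assumption+)
  have lim: "(\<lambda>n. F (r n) s) \<longlonglongrightarrow> g s" if "s \<in> {a..b}" for s
    unfolding LIMSEQ_iff using g(3) that by blast
  define Y where "Y s = fst (g s)" for s
  define W where "W s = fst (snd (g s))" for s
  define H where "H s = snd (snd (g s))" for s
  have limY: "(\<lambda>n. y (r n) s) \<longlonglongrightarrow> Y s" and limW: "(\<lambda>n. w (r n) s) \<longlonglongrightarrow> W s"
    and limH: "(\<lambda>n. G (r n) s) \<longlonglongrightarrow> H s" if "s \<in> {a..b}" for s
    using tendsto_fst[OF lim[OF that]] tendsto_fst[OF tendsto_snd[OF lim[OF that]]] tendsto_snd[OF tendsto_snd[OF lim[OF that]]]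
    by (simp_all add: F_def Y_def W_def H_def)
  have cY: "continuous_on {a..b} Y" and cW: "continuous_on {a..b} W" and cH: "continuous_on {a..b} H"
    unfolding Y_def W_def H_def by (intro continuous_intros g(1))+
  have limk: "(\<lambda>n. k (r n)) \<longlonglongrightarrow> k'"
    using LIMSEQ_subseq_LIMSEQ[OF k g(2)] by (simp add: o_def)
  have Ha: "H a = 0" using limH[of a] \<open>a \<le> b\<close> Ga by (simp add: LIMSEQ_const_iff)
  have Hb: "n1\<^sup>2 * (t - s) \<le> H t - H s \<and> H t - H s \<le> n2\<^sup>2 * (t - s)"
    if "a \<le> s" "s \<le> t" "t \<le> b" for s t
  proof -
    have "(\<lambda>n. G (r n) t - G (r n) s) \<longlonglongrightarrow> H t - H s"
      by (intro tendsto_diff limH) (use that in auto)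
    then show ?thesis
      using G[OF that(1,2)] by (auto intro: LIMSEQ_le_const LIMSEQ_le_const2)
  qed
  obtain \<epsilon>' where \<epsilon>': "regular_control n1 n2 \<epsilon>'" "\<And>t. t \<in> {a..b} \<Longrightarrow> (\<epsilon>' has_integral (H t - H a)) {a..t}"
    using control_of_primitive[OF n \<open>a \<le> b\<close> Hb] by blast
  have \<epsilon>'H: "\<And>t. t \<in> {a..b} \<Longrightarrow> (\<epsilon>' has_integral H t) {a..t}" using \<epsilon>'(2) Ha by simp
  have GH: "\<And>n t. t \<in> {a..b} \<Longrightarrow> (\<epsilon> n has_integral G n t) {a..t}"
    unfolding G_def by (intro integrable_integral regular_control_integrable[OF l(1)])
  have Yeq: "Y t = Y a + integral {a..t} (\<lambda>s. \<i> * k' * W s)" if t: "t \<in> {a..b}" for t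
  proof -
    have "(\<lambda>n. integral {a..t} (\<lambda>s. \<i> * k (r n) * w (r n) s)) \<longlonglongrightarrow> integral {a..t} (\<lambda>s. \<i> * k' * W s)"
    proof (rule dominated_convergence(2)[where h = "\<lambda>_. M * R"])
      show "norm (\<i> * k (r n) * w (r n) s) \<le> M * R" if "s \<in> {a..t}" for n s
        unfolding norm_mult using M(2)[of "r n"] bw[of s "r n"] M(1) that t by (auto intro!: mult_mono)
      show "(\<lambda>n. \<i> * k (r n) * w (r n) s) \<longlonglongrightarrow> \<i> * k' * W s" if "s \<in> {a..t}" for s
        using that t by (intro tendsto_intros limk limW) auto
    qed (use t primitive_on_integrable[OF py] in auto)
    moreover have "integral {a..t} (\<lambda>s. \<i> * k (r n) * w (r n) s) = y (r n) t - y (r n) a" for n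
      using primitive_onD[OF py t, of "r n"] by simp
    moreover have "(\<lambda>n. y (r n) t - y (r n) a) \<longlonglongrightarrow> Y t - Y a"
      by (intro tendsto_diff limY) (use t in auto)
    ultimately have "Y t - Y a = integral {a..t} (\<lambda>s. \<i> * k' * W s)"
      using LIMSEQ_unique by auto
    then show ?thesis by (metis diff_add_cancel add.commute)
  qed
  have pY: "primitive_on a b Y (\<lambda>s. \<i> * k' * W s)"
  proof -
    have c: "continuous_on {a..b} (\<lambda>s. \<i> * k' * W s)" by (intro continuous_intros cW)
    obtain B where "\<And>s. s \<in> {a..b} \<Longrightarrow> norm (\<i> * k' * W s) \<le> B" using continuous_bounded_interval[OF c] by blast
    then show ?thesis using Yeq by (intro primitive_onI[OF measurable_continuous_interval[OF c]])
  qed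
  \<comment> \<open>The product of \<epsilon> and y is replaced by its integrated form before and after the limit.\<close>
  have Weq: "W t = W a + integral {a..t} (\<lambda>s. \<i> * k' * of_real (\<epsilon>' s) * Y s)" if t: "t \<in> {a..b}" for t
  proof -
    have parts: "integral {a..t} (\<lambda>s. of_real (\<epsilon> n s) * y n s) =
        of_real (G n t) * y n t - integral {a..t} (\<lambda>s. of_real (G n s) * (\<i> * k n * w n s))" for n
      by (rule control_integral_by_parts[OF l(1) GH py _ t]) (auto intro!: continuous_intros cont)
    have parts': "integral {a..t} (\<lambda>s. of_real (\<epsilon>' s) * Y s) =
        of_real (H t) * Y t - integral {a..t} (\<lambda>s. of_real (H s) * (\<i> * k' * W s))"
      by (rule control_integral_by_parts[OF \<epsilon>'(1) \<epsilon>'H pY _ t]) (auto intro!: continuous_intros cW)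
    have Gb: "norm (complex_of_real (G n s)) \<le> n2\<^sup>2 * (b - a)" if "s \<in> {a..b}" for n s
    proof -
      have "0 \<le> n1\<^sup>2 * (s - a)" "n2\<^sup>2 * (s - a) \<le> n2\<^sup>2 * (b - a)"
        using that by (auto intro: mult_left_mono)
      moreover have "n1\<^sup>2 * (s - a) \<le> G n s \<and> G n s \<le> n2\<^sup>2 * (s - a)"
        using G[of a s n] that Ga[of n] by simp
      ultimately show ?thesis unfolding norm_of_real by linarith
    qed
    have "(\<lambda>n. integral {a..t} (\<lambda>s. of_real (G (r n) s) * (\<i> * k (r n) * w (r n) s))) \<longlonglongrightarrow>
        integral {a..t} (\<lambda>s. of_real (H s) * (\<i> * k' * W s))"
    proof (rule dominated_convergence(2)[where h = "\<lambda>_. n2\<^sup>2 * (b - a) * (M * R)"])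
      fix n s assume "s \<in> {a..t}"
      then have s: "s \<in> {a..b}" using t by auto
      have "norm (\<i> * k (r n) * w (r n) s) \<le> M * R"
        unfolding norm_mult using M(2)[of "r n"] bw[OF s] M(1) by (auto intro!: mult_mono)
      then show "norm (complex_of_real (G (r n) s) * (\<i> * k (r n) * w (r n) s)) \<le> n2\<^sup>2 * (b - a) * (M * R)"
        unfolding norm_mult[of "complex_of_real _"] using Gb[OF s] \<open>a \<le> b\<close> by (intro mult_mono) auto
    next
      fix s assume "s \<in> {a..t}"
      then have s: "s \<in> {a..b}" using t by auto
      show "(\<lambda>n. complex_of_real (G (r n) s) * (\<i> * k (r n) * w (r n) s)) \<longlonglongrightarrow> of_real (H s) * (\<i> * k' * W s)"
        by (intro tendsto_intros limk limW limH s)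
    next
      fix n
      have cG: "continuous_on {a..b} (\<lambda>s. complex_of_real (G (r n) s))"
        by (rule primitive_on_continuous[OF control_primitive[OF l(1) GH]])
      have "continuous_on {a..b} (\<lambda>s. complex_of_real (G (r n) s) * (\<i> * k (r n) * w (r n) s))"
        by (intro continuous_intros cG cont)
      then show "(\<lambda>s. complex_of_real (G (r n) s) * (\<i> * k (r n) * w (r n) s)) integrable_on {a..t}"
        by (intro integrable_continuous_interval) (rule continuous_on_subset, use t in auto)
    qed auto
    then have "(\<lambda>n. of_real (G (r n) t) * y (r n) t - integral {a..t} (\<lambda>s. of_real (G (r n) s) * (\<i> * k (r n) * w (r n) s)))
        \<longlonglongrightarrow> of_real (H t) * Y t - integral {a..t} (\<lambda>s. of_real (H s) * (\<i> * k' * W s))"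
      by (intro tendsto_intros limH limY t)
    then have "(\<lambda>n. integral {a..t} (\<lambda>s. of_real (\<epsilon> (r n) s) * y (r n) s)) \<longlonglongrightarrow> integral {a..t} (\<lambda>s. of_real (\<epsilon>' s) * Y s)"
      by (simp only: parts parts')
    then have "(\<lambda>n. \<i> * k (r n) * integral {a..t} (\<lambda>s. of_real (\<epsilon> (r n) s) * y (r n) s)) \<longlonglongrightarrow>
        \<i> * k' * integral {a..t} (\<lambda>s. of_real (\<epsilon>' s) * Y s)"
      by (intro tendsto_intros limk)
    moreover have "\<i> * k (r n) * integral {a..t} (\<lambda>s. of_real (\<epsilon> (r n) s) * y (r n) s) = w (r n) t - w (r n) a" for n
      using primitive_onD[OF pw t, of "r n"] by (simp add: mult.assoc)
    moreover have "(\<lambda>n. w (r n) t - w (r n) a) \<longlonglongrightarrow> W t - W a"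
      by (intro tendsto_diff limW) (use t in auto)
    ultimately have "W t - W a = \<i> * k' * integral {a..t} (\<lambda>s. of_real (\<epsilon>' s) * Y s)"
      using LIMSEQ_unique by auto
    then show ?thesis by (simp add: mult.assoc algebra_simps)
  qed
  have pW: "primitive_on a b W (\<lambda>s. \<i> * k' * of_real (\<epsilon>' s) * Y s)"
  proof -
    have c: "continuous_on {a..b} (\<lambda>s. \<i> * k' * Y s)" by (intro continuous_intros cY)
    have e: "(\<lambda>s. \<i> * k' * of_real (\<epsilon>' s) * Y s) = (\<lambda>s. of_real (\<epsilon>' s) * (\<i> * k' * Y s))" by (auto simp: mult_ac)
    obtain B where "\<And>s. s \<in> {a..b} \<Longrightarrow> norm (of_real (\<epsilon>' s) * (\<i> * k' * Y s)) \<le> B"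
      using control_mult_measurable_bounded(2)[OF \<epsilon>'(1) c] by blast
    then show ?thesis using Weq unfolding e
      by (intro primitive_onI[OF control_mult_measurable_bounded(1)[OF \<epsilon>'(1) c]])
  qed
  have sys: "linear_system k' \<epsilon>' a b Y W" using pY pW by (simp add: linear_system_def)
  have ab: "a \<in> {a..b}" "b \<in> {a..b}" using \<open>a \<le> b\<close> by auto
  \<comment> \<open>The normalisation survives the limit, so the limit solution is nontrivial.\<close>
  have "(\<lambda>n. norm (y (r n) a) + norm (w (r n) a)) \<longlonglongrightarrow> norm (Y a) + norm (W a)"
    by (intro tendsto_intros limY limW ab)
  then have "norm (Y a) + norm (W a) = 1" using yw(5) by (simp add: LIMSEQ_const_iff)
  then have "Y a \<noteq> 0 \<or> W a \<noteq> 0" by auto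
  then have nz: "Y s \<noteq> 0 \<or> W s \<noteq> 0" if "s \<in> {a..b}" for s
    using linear_system_nonvanishing[OF sys \<epsilon>'(1) ab(1) _ that] by blast
  have "ratio (Y a) (W a) = \<eta>1"
    by (rule ratio_limit[OF limY[OF ab(1)] limW[OF ab(1)] nz[OF ab(1)] yw(2)[OF ab(1)] yw(3)])
  moreover have "ratio (Y b) (W b) = \<eta>2"
    by (rule ratio_limit[OF limY[OF ab(2)] limW[OF ab(2)] nz[OF ab(2)] yw(2)[OF ab(2)] yw(4)])
  ultimately have "linked k' \<epsilon>' a b \<eta>1 \<eta>2" unfolding linked_def using sys nz by blast
  then show ?thesis using that \<epsilon>'(1) by blast
qed

section \<open>Rescaling time\<close>

lemma regular_control_rescale:
  "regular_control n1 n2 \<epsilon> \<Longrightarrow> regular_control n1 n2 (\<lambda>s. \<epsilon> (a + c * (s - a)))"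
  unfolding regular_control_def
  by (auto intro: measurable_compose[where f = "\<lambda>s. a + c * (s - a)" and N = borel])

text \<open>If y and w solve the system with parameter k, then y and w composed with an affine change of time
of speed c solve the system with parameter k c.\<close>

lemma linked_rescale:
  assumes r: "regular_control n1 n2 \<epsilon>" and c: "0 < c" and "a \<le> b"
    and l: "linked k \<epsilon> a (a + c * (b - a)) \<eta>1 \<eta>2"
  shows "linked (k * of_real c) (\<lambda>s. \<epsilon> (a + c * (s - a))) a b \<eta>1 \<eta>2"
proof -
  define \<phi> where "\<phi> s = a + c * (s - a)" for s
  define d where "d = \<phi> b"
  obtain y w where yw: "linear_system k \<epsilon> a d y w" "\<And>s. s \<in> {a..d} \<Longrightarrow> y s \<noteq> 0 \<or> w s \<noteq> 0"
    "ratio (y a) (w a) = \<eta>1" "ratio (y d) (w d) = \<eta>2"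
    using l unfolding linked_def d_def \<phi>_def by blast
  have \<phi>: "\<phi> s \<in> {a..d}" if "s \<in> {a..b}" for s
    using that c mult_left_mono[of "s - a" "b - a" c] by (auto simp: \<phi>_def d_def)
  have c\<phi>: "continuous_on {a..b} (\<lambda>s. g (\<phi> s))" if "continuous_on {a..d} g" for g :: "real \<Rightarrow> complex"
    by (rule continuous_on_compose2[OF that, of _ \<phi>]) (use \<phi> in \<open>auto simp: \<phi>_def[abs_def] intro!: continuous_intros\<close>)
  have integral: "f (\<phi> t) = f (\<phi> a) + integral {a..t} (\<lambda>s. of_real c * F (\<phi> s))"
    if p: "primitive_on a d f F" and t: "t \<in> {a..b}" for f F t
  proof -
    have "(F has_integral integral {a..\<phi> t} F) (cbox a (\<phi> t))"
      using primitive_on_integrable[OF p, of a "\<phi> t"] \<phi>[OF t] by (auto intro: integrable_integral)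
    note has_integral_affinity'[OF this c, of "a - c * a"]
    moreover have "(a - (a - c * a)) /\<^sub>R c = a" "(\<phi> t - (a - c * a)) /\<^sub>R c = t"
      using c by (auto simp: \<phi>_def field_simps)
    moreover have "c *\<^sub>R s + (a - c * a) = \<phi> s" for s by (simp add: \<phi>_def algebra_simps)
    ultimately have "((\<lambda>s. F (\<phi> s)) has_integral integral {a..\<phi> t} F /\<^sub>R c) {a..t}"
      by (simp only: DIM_real power_one_right box_real)
    then have "integral {a..t} (\<lambda>s. of_real c * F (\<phi> s)) = of_real c * (integral {a..\<phi> t} F /\<^sub>R c)"
      by (intro integral_unique has_integral_mult_right)
    also have "\<dots> = integral {a..\<phi> t} F"
      using c by (simp add: scaleR_conv_of_real)
    finally have "integral {a..t} (\<lambda>s. of_real c * F (\<phi> s)) = integral {a..\<phi> t} F" .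
    moreover have "\<phi> a = a" by (simp add: \<phi>_def)
    ultimately show ?thesis using primitive_onD[OF p \<phi>[OF t]] by metis
  qed
  have r': "regular_control n1 n2 (\<lambda>s. \<epsilon> (\<phi> s))"
    unfolding \<phi>_def by (rule regular_control_rescale[OF r])
  have cy: "continuous_on {a..b} (\<lambda>s. y (\<phi> s))" and cw: "continuous_on {a..b} (\<lambda>s. w (\<phi> s))"
    by (intro c\<phi> linear_system_continuous[OF yw(1)])+
  let ?k = "k * of_real c"
  have "primitive_on a b (\<lambda>s. y (\<phi> s)) (\<lambda>s. \<i> * ?k * w (\<phi> s))"
  proof -
    have cc: "continuous_on {a..b} (\<lambda>s. \<i> * ?k * w (\<phi> s))" by (intro continuous_intros cw)
    obtain B where B: "\<And>s. s \<in> {a..b} \<Longrightarrow> norm (\<i> * ?k * w (\<phi> s)) \<le> B"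
      using continuous_bounded_interval[OF cc] by blast
    show ?thesis
    proof (rule primitive_onI[OF measurable_continuous_interval[OF cc] B])
      fix t assume t: "t \<in> {a..b}"
      have "y (\<phi> t) = y (\<phi> a) + integral {a..t} (\<lambda>s. of_real c * (\<i> * k * w (\<phi> s)))"
        by (rule integral[OF _ t]) (use yw(1) in \<open>simp add: linear_system_def\<close>)
      then show "y (\<phi> t) = y (\<phi> a) + integral {a..t} (\<lambda>s. \<i> * ?k * w (\<phi> s))"
        by (simp only: mult_ac)
    qed
  qed
  moreover have "primitive_on a b (\<lambda>s. w (\<phi> s)) (\<lambda>s. \<i> * ?k * of_real (\<epsilon> (\<phi> s)) * y (\<phi> s))"
  proof -
    have cc: "continuous_on {a..b} (\<lambda>s. \<i> * ?k * y (\<phi> s))" by (intro continuous_intros cy)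
    obtain B where B: "\<And>s. s \<in> {a..b} \<Longrightarrow> norm (of_real (\<epsilon> (\<phi> s)) * (\<i> * ?k * y (\<phi> s))) \<le> B"
      using control_mult_measurable_bounded(2)[OF r' cc] by blast
    have "primitive_on a b (\<lambda>s. w (\<phi> s)) (\<lambda>s. of_real (\<epsilon> (\<phi> s)) * (\<i> * ?k * y (\<phi> s)))"
    proof (rule primitive_onI[OF control_mult_measurable_bounded(1)[OF r' cc] B])
      fix t assume t: "t \<in> {a..b}"
      have "w (\<phi> t) = w (\<phi> a) + integral {a..t} (\<lambda>s. of_real c * (\<i> * k * of_real (\<epsilon> (\<phi> s)) * y (\<phi> s)))"
        by (rule integral[OF _ t]) (use yw(1) in \<open>simp add: linear_system_def\<close>)
      then show "w (\<phi> t) = w (\<phi> a) + integral {a..t} (\<lambda>s. of_real (\<epsilon> (\<phi> s)) * (\<i> * ?k * y (\<phi> s)))"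
        by (simp only: mult_ac)
    qed
    then show ?thesis by (rule primitive_on_cong) (auto simp: mult_ac)
  qed
  ultimately have "linear_system ?k (\<lambda>s. \<epsilon> (\<phi> s)) a b (\<lambda>s. y (\<phi> s)) (\<lambda>s. w (\<phi> s))"
    by (simp add: linear_system_def)
  moreover have "\<phi> a = a" "\<phi> b = d" by (simp_all add: \<phi>_def d_def)
  ultimately have "linked ?k (\<lambda>s. \<epsilon> (\<phi> s)) a b \<eta>1 \<eta>2"
    unfolding linked_def using yw \<phi>
    by (intro exI[of _ "\<lambda>s. y (\<phi> s)"] exI[of _ "\<lambda>s. w (\<phi> s)"]) simp
  then show ?thesis by (simp add: \<phi>_def)
qed

section \<open>Transfer times, eigenvalue moduli and their minima\<close>

text \<open>The common core of controllability in time b - a with spectral parameter k and, for nonzero k, of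
membership of k in the union of the spectra over all feasible controls.\<close>

definition linkable :: "real \<Rightarrow> real \<Rightarrow> complex \<Rightarrow> real \<Rightarrow> real \<Rightarrow> sphere \<Rightarrow> sphere \<Rightarrow> bool" where
  "linkable n1 n2 k a b \<eta>1 \<eta>2 \<longleftrightarrow> (\<exists>\<epsilon>. regular_control n1 n2 \<epsilon> \<and> linked k \<epsilon> a b \<eta>1 \<eta>2)"

lemma linkable_rescale:
  assumes "0 < t" "a < b"
  shows "linkable n1 n2 k a (a + t) \<eta>1 \<eta>2 \<longleftrightarrow> linkable n1 n2 (k * of_real (t / (b - a))) a b \<eta>1 \<eta>2"
proof -
  define c where "c = t / (b - a)"
  have c: "0 < c" "a + c * (b - a) = a + t" "a + 1 / c * (a + t - a) = b" using assms by (auto simp: c_def)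
  have inv: "k * of_real c * of_real (1 / c) = k" using c(1) by simp
  show ?thesis
    unfolding c_def[symmetric]
  proof
    assume "linkable n1 n2 k a (a + t) \<eta>1 \<eta>2"
    then obtain \<epsilon> where \<epsilon>: "regular_control n1 n2 \<epsilon>" "linked k \<epsilon> a (a + c * (b - a)) \<eta>1 \<eta>2"
      unfolding linkable_def c(2) by blast
    show "linkable n1 n2 (k * of_real c) a b \<eta>1 \<eta>2"
      unfolding linkable_def
      using linked_rescale[OF \<epsilon>(1) c(1) less_imp_le[OF assms(2)] \<epsilon>(2)] regular_control_rescale[OF \<epsilon>(1)] by blast
  next
    assume "linkable n1 n2 (k * of_real c) a b \<eta>1 \<eta>2"
    then obtain \<epsilon> where \<epsilon>: "regular_control n1 n2 \<epsilon>" "linked (k * of_real c) \<epsilon> a (a + 1 / c * (a + t - a)) \<eta>1 \<eta>2"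
      unfolding linkable_def c(3) by blast
    have "linked k (\<lambda>s. \<epsilon> (a + 1 / c * (s - a))) a (a + t) \<eta>1 \<eta>2"
      using linked_rescale[OF \<epsilon>(1) _ _ \<epsilon>(2)] c(1) assms(1) unfolding inv by simp
    then show "linkable n1 n2 k a (a + t) \<eta>1 \<eta>2"
      unfolding linkable_def using regular_control_rescale[OF \<epsilon>(1)] by blast
  qed
qed

lemma steering_iff_linkable:
  assumes n: "n1\<^sup>2 \<le> n2\<^sup>2" and "0 \<le> t"
  shows "(\<exists>\<epsilon>\<in>feasible n1 n2 {a<..}. steers \<kappa> \<epsilon> a t \<eta>1 \<eta>2) \<longleftrightarrow> linkable n1 n2 \<kappa> a (a + t) \<eta>1 \<eta>2"
proof
  assume "\<exists>\<epsilon>\<in>feasible n1 n2 {a<..}. steers \<kappa> \<epsilon> a t \<eta>1 \<eta>2"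
  then obtain \<epsilon> where \<epsilon>: "\<epsilon> \<in> feasible n1 n2 {a<..}" "steers \<kappa> \<epsilon> a t \<eta>1 \<eta>2" by blast
  obtain \<epsilon>' N where r: "regular_control n1 n2 \<epsilon>'" and N: "negligible N" "\<And>s. s \<in> {a..a + t} - N \<Longrightarrow> \<epsilon> s = \<epsilon>' s"
    by (rule feasible_regularize[OF \<epsilon>(1) _ _ n, of a "a + t"]) auto
  have "steers \<kappa> \<epsilon>' a t \<eta>1 \<eta>2" using \<epsilon>(2) steers_cong_ae[OF N] by simp
  then show "linkable n1 n2 \<kappa> a (a + t) \<eta>1 \<eta>2"
    using steers_iff_linked[OF r \<open>0 \<le> t\<close>] r unfolding linkable_def by blast
next
  assume "linkable n1 n2 \<kappa> a (a + t) \<eta>1 \<eta>2"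
  then show "\<exists>\<epsilon>\<in>feasible n1 n2 {a<..}. steers \<kappa> \<epsilon> a t \<eta>1 \<eta>2"
    unfolding linkable_def using steers_iff_linked[OF _ \<open>0 \<le> t\<close>] regular_control_feasible by metis
qed

lemma eigenvalue_set_iff_linkable:
  assumes n: "n1\<^sup>2 \<le> n2\<^sup>2" and "a < b"
  shows "k \<in> feasible_eigenvalues n1 n2 a b \<eta>1 \<eta>2 \<longleftrightarrow> k \<noteq> 0 \<and> linkable n1 n2 k a b \<eta>1 \<eta>2"
proof
  assume "k \<in> feasible_eigenvalues n1 n2 a b \<eta>1 \<eta>2"
  then obtain \<epsilon> where \<epsilon>: "\<epsilon> \<in> feasible n1 n2 {a<..<b}" "k \<in> eigenvalues a b \<eta>1 \<eta>2 \<epsilon>"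
    unfolding feasible_eigenvalues_def by blast
  obtain \<epsilon>' N where r: "regular_control n1 n2 \<epsilon>'" and N: "negligible N" "\<And>s. s \<in> {a..b} - N \<Longrightarrow> \<epsilon> s = \<epsilon>' s"
    by (rule feasible_regularize[OF \<epsilon>(1) _ _ n, of a b]) auto
  have "k \<in> eigenvalues a b \<eta>1 \<eta>2 \<epsilon>'" using \<epsilon>(2) eigenvalues_cong_ae[OF N] by simp
  then show "k \<noteq> 0 \<and> linkable n1 n2 k a b \<eta>1 \<eta>2"
    using eigenvalue_iff_linked[OF \<open>a < b\<close> r] r unfolding linkable_def by blast
next
  assume "k \<noteq> 0 \<and> linkable n1 n2 k a b \<eta>1 \<eta>2"
  then show "k \<in> feasible_eigenvalues n1 n2 a b \<eta>1 \<eta>2"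
    unfolding linkable_def feasible_eigenvalues_def UN_iff
    using eigenvalue_iff_linked[OF \<open>a < b\<close>] regular_control_feasible by metis
qed

lemma linked_zero:
  assumes "linked 0 \<epsilon> a b \<eta>1 \<eta>2" "a \<le> b"
  shows "\<eta>1 = \<eta>2"
proof -
  obtain y w where "linear_system 0 \<epsilon> a b y w" "ratio (y a) (w a) = \<eta>1" "ratio (y b) (w b) = \<eta>2"
    using assms(1) unfolding linked_def by blast
  moreover from this have "y b = y a" "w b = w a"
    using primitive_onD[of a b y "\<lambda>s. 0" b] primitive_onD[of a b w "\<lambda>s. 0" b] assms(2)
    by (auto simp: linear_system_def)
  ultimately show ?thesis by simp
qed

text \<open>A minimising sequence of moduli has a limit parameter that is again linkable by compactness. The
limit is not 0, for the system with parameter 0 has constant solutions.\<close>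

lemma linkable_moduli_attain_inf:
  assumes n: "n1\<^sup>2 < n2\<^sup>2" and "a < b" "\<eta>1 \<noteq> \<eta>2"
    and R: "R = {\<rho>. 0 < \<rho> \<and> linkable n1 n2 (cis \<gamma> * of_real \<rho>) a b \<eta>1 \<eta>2}" "R \<noteq> {}"
  shows "Inf R \<in> R" "\<And>\<rho>. \<rho> \<in> R \<Longrightarrow> Inf R \<le> \<rho>"
proof -
  have bdd: "bdd_below R" by (rule bdd_belowI[of _ 0]) (auto simp: R(1))
  then show low: "\<And>\<rho>. \<rho> \<in> R \<Longrightarrow> Inf R \<le> \<rho>" by (intro cInf_lower)
  have "Inf R \<in> closure R" by (rule closure_contains_Inf[OF R(2) bdd])
  then obtain \<rho> where \<rho>: "\<And>n. \<rho> n \<in> R" "\<rho> \<longlonglongrightarrow> Inf R" unfolding closure_sequential by blast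
  have "\<forall>n. \<exists>\<epsilon>. regular_control n1 n2 \<epsilon> \<and> linked (cis \<gamma> * of_real (\<rho> n)) \<epsilon> a b \<eta>1 \<eta>2"
    using \<rho>(1) unfolding R(1) linkable_def by blast
  then obtain \<epsilon> where \<epsilon>: "\<And>n. regular_control n1 n2 (\<epsilon> n)" "\<And>n. linked (cis \<gamma> * of_real (\<rho> n)) (\<epsilon> n) a b \<eta>1 \<eta>2"
    by metis
  have lim: "(\<lambda>n. cis \<gamma> * of_real (\<rho> n)) \<longlonglongrightarrow> cis \<gamma> * of_real (Inf R)" by (intro tendsto_intros \<rho>(2))
  obtain \<epsilon>' where \<epsilon>': "regular_control n1 n2 \<epsilon>'" "linked (cis \<gamma> * of_real (Inf R)) \<epsilon>' a b \<eta>1 \<eta>2"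
    by (rule linked_compact[OF n less_imp_le[OF \<open>a < b\<close>] lim \<epsilon>])
  have "0 \<le> Inf R" using R(2) by (intro cInf_greatest) (auto simp: R(1))
  moreover have "Inf R \<noteq> 0"
  proof
    assume "Inf R = 0"
    then have "linked 0 \<epsilon>' a b \<eta>1 \<eta>2" using \<epsilon>'(2) by simp
    then show False using linked_zero \<open>\<eta>1 \<noteq> \<eta>2\<close> \<open>a < b\<close> by auto
  qed
  ultimately have "0 < Inf R" by simp
  then show "Inf R \<in> R" using \<epsilon>' unfolding R(1) linkable_def by blast
qed

text \<open>Control by control, steering over [a, b] and having \<kappa> as an eigenvalue are the same property; this
is what identifies the families of optimal controls, not only the optimal values.\<close>

lemma steers_iff_eigenvalue:
  assumes \<epsilon>: "\<epsilon> \<in> feasible n1 n2 I" and I: "I \<in> sets lebesgue" "{a<..<b} \<subseteq> I" and n: "n1\<^sup>2 \<le> n2\<^sup>2"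
    and "a < b" "\<kappa> \<noteq> 0"
  shows "steers \<kappa> \<epsilon> a (b - a) \<eta>1 \<eta>2 \<longleftrightarrow> \<kappa> \<in> eigenvalues a b \<eta>1 \<eta>2 \<epsilon>"
proof -
  obtain \<epsilon>' N where r: "regular_control n1 n2 \<epsilon>'" and N: "negligible N" "\<And>s. s \<in> {a..b} - N \<Longrightarrow> \<epsilon> s = \<epsilon>' s"
    using feasible_regularize[OF \<epsilon> I n] by blast
  have "steers \<kappa> \<epsilon> a (b - a) \<eta>1 \<eta>2 \<longleftrightarrow> steers \<kappa> \<epsilon>' a (b - a) \<eta>1 \<eta>2"
    by (rule steers_cong_ae[OF N(1)]) (use N(2) in simp)
  also have "\<dots> \<longleftrightarrow> linked \<kappa> \<epsilon>' a b \<eta>1 \<eta>2"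
    using steers_iff_linked[OF r, of "b - a" \<kappa> a] \<open>a < b\<close> by simp
  also have "\<dots> \<longleftrightarrow> \<kappa> \<in> eigenvalues a b \<eta>1 \<eta>2 \<epsilon>'"
    using eigenvalue_iff_linked[OF \<open>a < b\<close> r] \<open>\<kappa> \<noteq> 0\<close> by simp
  also have "eigenvalues a b \<eta>1 \<eta>2 \<epsilon>' = eigenvalues a b \<eta>1 \<eta>2 \<epsilon>"
    by (rule eigenvalues_cong_ae[OF N(1), symmetric]) (rule N(2))
  finally show ?thesis .
qed

lemma feasible_mono:
  assumes "\<epsilon> \<in> feasible n1 n2 I" "J \<subseteq> I" "I \<in> sets lebesgue" "J \<in> sets lebesgue"
  shows "\<epsilon> \<in> feasible n1 n2 J"
proof -
  have "AE s in lebesgue. s \<in> I \<longrightarrow> n1\<^sup>2 \<le> \<epsilon> s \<and> \<epsilon> s \<le> n2\<^sup>2"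
    using assms by (subst AE_restrict_space_iff[symmetric]) (auto simp: feasible_def)
  then have "AE s in lebesgue. s \<in> J \<longrightarrow> n1\<^sup>2 \<le> \<epsilon> s \<and> \<epsilon> s \<le> n2\<^sup>2"
    by (rule eventually_mono) (use assms(2) in auto)
  then have "AE s in lebesgue_on J. n1\<^sup>2 \<le> \<epsilon> s \<and> \<epsilon> s \<le> n2\<^sup>2"
    using assms(4) by (subst AE_restrict_space_iff) auto
  moreover have "\<epsilon> \<in> borel_measurable (lebesgue_on J)"
    by (rule measurable_restrict_mono[OF _ assms(2)]) (use assms(1) in \<open>simp add: feasible_def\<close>)
  ultimately show ?thesis unfolding feasible_def by blast
qed

lemma feasible_extend:
  assumes "\<epsilon> \<in> feasible n1 n2 J" "J \<in> sets lebesgue" "n1\<^sup>2 \<le> n2\<^sup>2" "I \<in> sets lebesgue"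
  shows "(\<lambda>s. if s \<in> J then \<epsilon> s else n1\<^sup>2) \<in> feasible n1 n2 I"
proof -
  have "(\<lambda>s. \<epsilon> s - n1\<^sup>2) \<in> borel_measurable (lebesgue_on J)"
    using assms(1) by (auto simp: feasible_def)
  then have "(\<lambda>s. if s \<in> J then \<epsilon> s - n1\<^sup>2 else 0) \<in> borel_measurable lebesgue"
    using assms(2) by (simp add: borel_measurable_if)
  then have "(\<lambda>s. (if s \<in> J then \<epsilon> s - n1\<^sup>2 else 0) + n1\<^sup>2) \<in> borel_measurable lebesgue" by simp
  also have "(\<lambda>s. (if s \<in> J then \<epsilon> s - n1\<^sup>2 else 0) + n1\<^sup>2) = (\<lambda>s. if s \<in> J then \<epsilon> s else n1\<^sup>2)" by auto
  finally have "(\<lambda>s. if s \<in> J then \<epsilon> s else n1\<^sup>2) \<in> borel_measurable (lebesgue_on I)"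
    by (rule measurable_restrict_space1)
  moreover have "AE s in lebesgue. s \<in> J \<longrightarrow> n1\<^sup>2 \<le> \<epsilon> s \<and> \<epsilon> s \<le> n2\<^sup>2"
    using assms(1,2) by (subst AE_restrict_space_iff[symmetric]) (auto simp: feasible_def)
  then have "AE s in lebesgue. s \<in> I \<longrightarrow> n1\<^sup>2 \<le> (if s \<in> J then \<epsilon> s else n1\<^sup>2) \<and> (if s \<in> J then \<epsilon> s else n1\<^sup>2) \<le> n2\<^sup>2"
    by (rule eventually_mono) (use assms(3) in auto)
  then have "AE s in lebesgue_on I. n1\<^sup>2 \<le> (if s \<in> J then \<epsilon> s else n1\<^sup>2) \<and> (if s \<in> J then \<epsilon> s else n1\<^sup>2) \<le> n2\<^sup>2"
    using assms(4) by (subst AE_restrict_space_iff) auto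
  ultimately show ?thesis by (simp add: feasible_def)
qed

theorem theorem3p2:
  fixes n1 n2 s1 s2 \<gamma> :: real and \<eta>1 \<eta>2 :: sphere and \<kappa> :: complex
  assumes "0 < n1" and "n1 < n2" and "s1 < s2" and "\<eta>1 \<noteq> \<eta>2" and "\<kappa> \<noteq> 0" and "\<gamma> = Arg \<kappa>"
  shows
    "(controllable n1 n2 \<kappa> s1 \<eta>1 \<eta>2 \<longleftrightarrow> min_time_controls n1 n2 \<kappa> s1 \<eta>1 \<eta>2 \<noteq> {}) \<and>
     (controllable n1 n2 \<kappa> s1 \<eta>1 \<eta>2 \<longleftrightarrow> \<gamma> \<in> Arg ` feasible_eigenvalues n1 n2 s1 s2 \<eta>1 \<eta>2) \<and>
     (controllable n1 n2 \<kappa> s1 \<eta>1 \<eta>2 \<longleftrightarrow> min_modulus_resonators n1 n2 s1 s2 \<eta>1 \<eta>2 \<gamma> \<noteq> {}) \<and>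
     (controllable n1 n2 \<kappa> s1 \<eta>1 \<eta>2 \<longrightarrow>
        min_time n1 n2 \<kappa> s1 \<eta>1 \<eta>2 =
          ereal (s2 - s1) * min_modulus n1 n2 s1 s2 \<eta>1 \<eta>2 \<gamma> / ereal (cmod \<kappa>) \<and>
        (ereal (s2 - s1) = min_time n1 n2 \<kappa> s1 \<eta>1 \<eta>2 \<longrightarrow>
          (\<lambda>\<epsilon>. restrict \<epsilon> {s1<..<s2}) ` min_time_controls n1 n2 \<kappa> s1 \<eta>1 \<eta>2 =
          (\<lambda>\<epsilon>. restrict \<epsilon> {s1<..<s2}) ` min_modulus_resonators n1 n2 s1 s2 \<eta>1 \<eta>2 \<gamma>))"
proof -
  have n: "n1\<^sup>2 < n2\<^sup>2" using assms(1,2) by (simp add: power_strict_mono)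
  then have n': "n1\<^sup>2 \<le> n2\<^sup>2" by simp
  define L where "L = s2 - s1"
  define K where "K = cmod \<kappa>"
  have L: "0 < L" and K: "0 < K" using assms by (auto simp: L_def K_def)
  have \<kappa>: "\<kappa> = cis \<gamma> * of_real K"
    using assms(5,6) by (simp add: K_def cis_Arg sgn_div_norm scaleR_conv_of_real field_simps)
  have \<gamma>: "- pi < \<gamma>" "\<gamma> \<le> pi" using assms(6) Arg_bounded by auto
  \<comment> \<open>R consists of the moduli of the eigenvalues with argument \<gamma>; both infima are expressed by it.\<close>
  define R where "R = {\<rho>. 0 < \<rho> \<and> linkable n1 n2 (cis \<gamma> * of_real \<rho>) s1 s2 \<eta>1 \<eta>2}"
  have time: "(\<exists>\<epsilon>\<in>feasible n1 n2 {s1<..}. steers \<kappa> \<epsilon> s1 t \<eta>1 \<eta>2) \<longleftrightarrow> K * t / L \<in> R" if "0 \<le> t" for t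
  proof (cases "t = 0")
    case True
    \<comment> \<open>A transfer in time 0 is impossible because \<eta>1 and \<eta>2 differ.\<close>
    then have "\<not> steers \<kappa> \<epsilon> s1 t \<eta>1 \<eta>2" for \<epsilon> using assms(4) by (auto simp: steers_def)
    then show ?thesis using True by (simp add: R_def)
  next
    case False
    then have "0 < t" using that by simp
    then have "(\<exists>\<epsilon>\<in>feasible n1 n2 {s1<..}. steers \<kappa> \<epsilon> s1 t \<eta>1 \<eta>2) \<longleftrightarrow>
        linkable n1 n2 (\<kappa> * of_real (t / L)) s1 s2 \<eta>1 \<eta>2"
      unfolding steering_iff_linkable[OF n' that] L_def by (rule linkable_rescale) (rule assms(3))
    also have "\<kappa> * of_real (t / L) = cis \<gamma> * of_real (K * t / L)" unfolding \<kappa> by simp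
    finally show ?thesis using \<open>0 < t\<close> L K by (simp add: R_def)
  qed
  have spectrum: "k \<in> feasible_eigenvalues n1 n2 s1 s2 \<eta>1 \<eta>2 \<and> Arg k = \<gamma> \<longleftrightarrow> k = cis \<gamma> * of_real (cmod k) \<and> cmod k \<in> R" for k
  proof -
    have "Arg k = \<gamma> \<longleftrightarrow> k = cis \<gamma> * of_real (cmod k)" if "k \<noteq> 0"
    proof
      assume "Arg k = \<gamma>"
      then show "k = cis \<gamma> * of_real (cmod k)"
        using that cis_Arg[of k] by (simp add: sgn_div_norm scaleR_conv_of_real field_simps)
    next
      assume "k = cis \<gamma> * of_real (cmod k)"
      then show "Arg k = \<gamma>" using Arg_unique[of "cmod k" \<gamma> k] \<gamma> that by (simp add: cis_conv_exp mult.commute)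
    qed
    then show ?thesis
      unfolding eigenvalue_set_iff_linkable[OF n' assms(3)] R_def by (cases "k = 0") auto
  qed
  have R_mod: "\<rho> = cmod (cis \<gamma> * of_real \<rho>)" if "\<rho> \<in> R" for \<rho> using that by (simp add: R_def norm_mult)
  have moduli: "{ereal (cmod k) | k. k \<in> feasible_eigenvalues n1 n2 s1 s2 \<eta>1 \<eta>2 \<and> Arg k = \<gamma>} = ereal ` R"
    unfolding spectrum using R_mod by (auto simp: image_iff) metis
  have times: "{ereal t | t. 0 \<le> t \<and> (\<exists>\<epsilon>\<in>feasible n1 n2 {s1<..}. steers \<kappa> \<epsilon> s1 t \<eta>1 \<eta>2)} = (\<lambda>\<rho>. ereal (L * \<rho> / K)) ` R"
  proof -
    have "{t. 0 \<le> t \<and> (\<exists>\<epsilon>\<in>feasible n1 n2 {s1<..}. steers \<kappa> \<epsilon> s1 t \<eta>1 \<eta>2)} = (\<lambda>\<rho>. L * \<rho> / K) ` R"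
    proof (intro equalityI subsetI)
      fix t assume "t \<in> {t. 0 \<le> t \<and> (\<exists>\<epsilon>\<in>feasible n1 n2 {s1<..}. steers \<kappa> \<epsilon> s1 t \<eta>1 \<eta>2)}"
      then have "K * t / L \<in> R" using time by blast
      moreover have "t = L * (K * t / L) / K" using L K by simp
      ultimately show "t \<in> (\<lambda>\<rho>. L * \<rho> / K) ` R" by blast
    next
      fix t assume "t \<in> (\<lambda>\<rho>. L * \<rho> / K) ` R"
      then obtain \<rho> where \<rho>: "\<rho> \<in> R" "t = L * \<rho> / K" by blast
      then have "0 \<le> t" "K * t / L = \<rho>" using L K by (auto simp: R_def)
      then show "t \<in> {t. 0 \<le> t \<and> (\<exists>\<epsilon>\<in>feasible n1 n2 {s1<..}. steers \<kappa> \<epsilon> s1 t \<eta>1 \<eta>2)}"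
        using time \<rho>(1) by simp
    qed
    then show ?thesis by (auto simp: set_eq_iff image_iff)
  qed
  have contr: "controllable n1 n2 \<kappa> s1 \<eta>1 \<eta>2 \<longleftrightarrow> R \<noteq> {}"
  proof -
    have "controllable n1 n2 \<kappa> s1 \<eta>1 \<eta>2 \<longleftrightarrow>
        {ereal t | t. 0 \<le> t \<and> (\<exists>\<epsilon>\<in>feasible n1 n2 {s1<..}. steers \<kappa> \<epsilon> s1 t \<eta>1 \<eta>2)} \<noteq> {}"
      unfolding controllable_def by blast
    then show ?thesis unfolding times by simp
  qed
  have arg: "\<gamma> \<in> Arg ` feasible_eigenvalues n1 n2 s1 s2 \<eta>1 \<eta>2 \<longleftrightarrow> R \<noteq> {}"
  proof -
    have "\<gamma> \<in> Arg ` feasible_eigenvalues n1 n2 s1 s2 \<eta>1 \<eta>2 \<longleftrightarrow>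
        {ereal (cmod k) | k. k \<in> feasible_eigenvalues n1 n2 s1 s2 \<eta>1 \<eta>2 \<and> Arg k = \<gamma>} \<noteq> {}"
      by auto
    then show ?thesis unfolding moduli by simp
  qed
  show ?thesis
  proof (cases "R = {}")
    case True
    then have mm: "min_modulus n1 n2 s1 s2 \<eta>1 \<eta>2 \<gamma> = \<infinity>" "min_time n1 n2 \<kappa> s1 \<eta>1 \<eta>2 = \<infinity>"
      unfolding min_modulus_def min_time_def moduli times by (simp_all add: top_ereal_def)
    have "min_time_controls n1 n2 \<kappa> s1 \<eta>1 \<eta>2 = {}" "min_modulus_resonators n1 n2 s1 s2 \<eta>1 \<eta>2 \<gamma> = {}"
      unfolding min_time_controls_def min_modulus_resonators_def mm by simp_all
    then show ?thesis using contr arg True by simp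
  next
    case False
    define \<rho> where "\<rho> = Inf R"
    have \<rho>: "\<rho> \<in> R" "\<And>r. r \<in> R \<Longrightarrow> \<rho> \<le> r"
      unfolding \<rho>_def using linkable_moduli_attain_inf[OF n assms(3,4) R_def False] by auto
    then have "0 < \<rho>" by (simp add: R_def)
    have mod: "min_modulus n1 n2 s1 s2 \<eta>1 \<eta>2 \<gamma> = ereal \<rho>"
      unfolding min_modulus_def moduli using \<rho> by (intro antisym Inf_lower Inf_greatest) auto
    have tim: "min_time n1 n2 \<kappa> s1 \<eta>1 \<eta>2 = ereal (L * \<rho> / K)"
      unfolding min_time_def times
    proof (intro antisym Inf_lower Inf_greatest)
      fix z assume "z \<in> (\<lambda>\<rho>. ereal (L * \<rho> / K)) ` R"
      then obtain r where "r \<in> R" "z = ereal (L * r / K)" by blast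
      then show "ereal (L * \<rho> / K) \<le> z" using \<rho>(2)[of r] L K by (simp add: divide_right_mono)
    qed (use \<rho>(1) in auto)
    have T0: "0 \<le> L * \<rho> / K" using L K \<open>0 < \<rho>\<close> by simp
    have mtc: "min_time_controls n1 n2 \<kappa> s1 \<eta>1 \<eta>2 = {\<epsilon> \<in> feasible n1 n2 {s1<..}. steers \<kappa> \<epsilon> s1 (L * \<rho> / K) \<eta>1 \<eta>2}"
      unfolding min_time_controls_def tim using T0 by auto
    have mmr: "min_modulus_resonators n1 n2 s1 s2 \<eta>1 \<eta>2 \<gamma> =
        {\<epsilon> \<in> feasible n1 n2 {s1<..<s2}. cis \<gamma> * of_real \<rho> \<in> eigenvalues s1 s2 \<eta>1 \<eta>2 \<epsilon>}"
      unfolding min_modulus_resonators_def mod by auto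
    have "min_time_controls n1 n2 \<kappa> s1 \<eta>1 \<eta>2 \<noteq> {}"
      using time[OF T0] \<rho>(1) L K unfolding mtc by auto
    moreover have "min_modulus_resonators n1 n2 s1 s2 \<eta>1 \<eta>2 \<gamma> \<noteq> {}"
    proof -
      have "cis \<gamma> * of_real \<rho> \<in> feasible_eigenvalues n1 n2 s1 s2 \<eta>1 \<eta>2"
        using spectrum[of "cis \<gamma> * of_real \<rho>"] R_mod[OF \<rho>(1)] \<rho>(1) by simp
      then show ?thesis unfolding mmr feasible_eigenvalues_def by blast
    qed
    moreover have "ereal (L * \<rho> / K) = ereal L * ereal \<rho> / ereal K" using K by simp
    moreover have "(\<lambda>\<epsilon>. restrict \<epsilon> {s1<..<s2}) ` min_time_controls n1 n2 \<kappa> s1 \<eta>1 \<eta>2 =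
          (\<lambda>\<epsilon>. restrict \<epsilon> {s1<..<s2}) ` min_modulus_resonators n1 n2 s1 s2 \<eta>1 \<eta>2 \<gamma>"
      if "L = L * \<rho> / K"
    proof -
      have "\<rho> = K" using that L K by (simp add: field_simps)
      then have \<kappa>': "cis \<gamma> * of_real \<rho> = \<kappa>" using \<kappa> by simp
      have st: "steers \<kappa> \<epsilon> s1 (L * \<rho> / K) \<eta>1 \<eta>2 \<longleftrightarrow> \<kappa> \<in> eigenvalues s1 s2 \<eta>1 \<eta>2 \<epsilon>"
        if "\<epsilon> \<in> feasible n1 n2 {s1<..}" for \<epsilon>
        unfolding \<open>L = L * \<rho> / K\<close>[symmetric] unfolding L_def
        by (rule steers_iff_eigenvalue[OF that _ _ n' assms(3,5)]) auto
      have mtc': "min_time_controls n1 n2 \<kappa> s1 \<eta>1 \<eta>2 = {\<epsilon> \<in> feasible n1 n2 {s1<..}. \<kappa> \<in> eigenvalues s1 s2 \<eta>1 \<eta>2 \<epsilon>}"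
        unfolding mtc using st by blast
      have mmr': "min_modulus_resonators n1 n2 s1 s2 \<eta>1 \<eta>2 \<gamma> = {\<epsilon> \<in> feasible n1 n2 {s1<..<s2}. \<kappa> \<in> eigenvalues s1 s2 \<eta>1 \<eta>2 \<epsilon>}"
        unfolding mmr \<kappa>' ..
      show ?thesis
        unfolding mtc' mmr'
      proof (intro equalityI image_subsetI)
        have sub: "{s1<..<s2} \<subseteq> {s1<..}" by auto
        fix \<epsilon> assume "\<epsilon> \<in> {\<epsilon> \<in> feasible n1 n2 {s1<..}. \<kappa> \<in> eigenvalues s1 s2 \<eta>1 \<eta>2 \<epsilon>}"
        then have "\<epsilon> \<in> {\<epsilon> \<in> feasible n1 n2 {s1<..<s2}. \<kappa> \<in> eigenvalues s1 s2 \<eta>1 \<eta>2 \<epsilon>}"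
          using feasible_mono[of \<epsilon> n1 n2 "{s1<..}" "{s1<..<s2}", OF _ sub] by simp
        then show "restrict \<epsilon> {s1<..<s2} \<in> (\<lambda>\<epsilon>. restrict \<epsilon> {s1<..<s2}) ` {\<epsilon> \<in> feasible n1 n2 {s1<..<s2}. \<kappa> \<in> eigenvalues s1 s2 \<eta>1 \<eta>2 \<epsilon>}"
          by blast
      next
        fix \<epsilon> assume \<epsilon>: "\<epsilon> \<in> {\<epsilon> \<in> feasible n1 n2 {s1<..<s2}. \<kappa> \<in> eigenvalues s1 s2 \<eta>1 \<eta>2 \<epsilon>}"
        \<comment> \<open>A resonator is turned into a control on the half-line by an arbitrary admissible constant.\<close>
        define \<epsilon>' where "\<epsilon>' s = (if s \<in> {s1<..<s2} then \<epsilon> s else n1\<^sup>2)" for s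
        have "\<epsilon>' \<in> feasible n1 n2 {s1<..}"
          using feasible_extend[of \<epsilon> n1 n2 "{s1<..<s2}" "{s1<..}"] \<epsilon> n' unfolding \<epsilon>'_def by auto
        moreover have "eigenvalues s1 s2 \<eta>1 \<eta>2 \<epsilon> = eigenvalues s1 s2 \<eta>1 \<eta>2 \<epsilon>'"
          by (rule eigenvalues_cong_ae[of "{s1, s2}"]) (auto simp: \<epsilon>'_def)
        moreover have "restrict \<epsilon> {s1<..<s2} = restrict \<epsilon>' {s1<..<s2}" by (auto simp: \<epsilon>'_def restrict_def)
        ultimately show "restrict \<epsilon> {s1<..<s2} \<in> (\<lambda>\<epsilon>. restrict \<epsilon> {s1<..<s2}) ` {\<epsilon> \<in> feasible n1 n2 {s1<..}. \<kappa> \<in> eigenvalues s1 s2 \<eta>1 \<eta>2 \<epsilon>}"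
          using \<epsilon> by auto
      qed
    qed
    ultimately show ?thesis
      using contr arg False unfolding mod tim L_def[symmetric] K_def[symmetric] by auto
  qed
qed

end
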